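(* Let $b\in\{1,\dots,n\}$ and $m\ge1$. Run Free-SVRG (described in the context) with $b$-nice sampling, inner-loop length $m$ and step size $\alpha=\frac{1}{2(\mathcal L(b)+2\rho(b))}$, where $$\mathcal L(b)=\frac1b\frac{n-b}{n-1}L_{\max}+\frac nb\frac{b-1}{n-1}L,\qquad \rho(b)=\frac1b\frac{n-b}{n-1}L_{\max}.$$ Then for every $\epsilon>0$ the total complexity (number of individual gradient evaluations, counting $n+2bm$ per outer iteration) of finding an $\epsilon$-approximate solution satisfying $\mathbb E\|x_s^m-x^*\|_2^2\le\epsilon\,\phi_0$ is $$C_m(b):=2\left(\frac nm+2b\right)\max\left\{\frac{\mathcal L(b)+2\rho(b)}{\mu},\,m\right\}\log\left(\frac1\epsilon\right).$$ That is, for every integer $s\ge0$ with $s\,(n+2bm)\ge C_m(b)$, one has $\mathbb E\|x_s^m-x^*\|_2^2\le\epsilon\,\phi_0$. Here $\phi_0=\|x_0^m-x^*\|_2^2+8\alpha^2\rho(b)S_m(f(w_0)-f(x^* ))$.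
   Context: Setting: $n\ge2$, $f(x)=\frac1n\sum_{i=1}^n f_i(x)$ on $\mathbb R^d$ with minimizer $x^*$; $f$ is $L$-smooth, i.e. $f(x)\le f(y)+\langle\nabla f(y),x-y\rangle+\frac L2\|x-y\|_2^2$, and $\mu$-strongly convex with $\mu>0$, i.e. $f(x)\le f(y)+\langle\nabla f(x),x-y\rangle-\frac\mu2\|x-y\|_2^2$, for all $x,y$. Each $f_i$ is differentiable, convex and $L_i$-smooth; $L_{\max}=\max_iL_i$. $b$-nice sampling: $B\subseteq\{1,\dots,n\}$ is drawn uniformly among all subsets of size $b$; the associated sampling vector is $v=\frac nb\sum_{i\in B}e_i$, so $\nabla f_v(x)=\frac1n\sum_iv_i\nabla f_i(x)=\frac1b\sum_{i\in B}\nabla f_i(x)$. Notation: $S_m=\sum_{i=0}^{m-1}(1-\alpha\mu)^{m-1-i}$ and $p_t=\frac{(1-\alpha\mu)^{m-1-t}}{S_m}$ for $t=0,\dots,m-1$. Free-SVRG: initialize $w_0=x_0^m\in\mathbb R^d$ (deterministic). For $s=1,2,\dots$: set $x_s^0=x_{s-1}^m$; for $t=0,\dots,m-1$, sample a fresh independent copy $v_t$ of $v$, set $g_s^t=\nabla f_{v_t}(x_s^t)-\nabla f_{v_t}(w_{s-1})+\nabla f(w_{s-1})$ and $x_s^{t+1}=x_s^t-\alpha g_s^t$; then set $w_s=\sum_{t=0}^{m-1}p_tx_s^t$. Each outer iteration costs $n+2bm$ evaluations of individual gradients $\nabla f_i$. *)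

theory Defs
  imports "HOL-Probability.Probability"
begin

definition gradient :: "('a::euclidean_space \<Rightarrow> real) \<Rightarrow> 'a \<Rightarrow> 'a" where
  "gradient f x = (THE g. GDERIV f x :> g)"

lemma GDERIV_gradient:
  fixes f :: "'a::euclidean_space \<Rightarrow> real"
  assumes "f differentiable (at x)"
  shows "GDERIV f x :> gradient f x"
proof -
  obtain D where D: "(f has_derivative D) (at x)"
    using assms unfolding differentiable_def by blast
  then have lin: "bounded_linear D" by (rule has_derivative_bounded_linear)
  define g where "g = (\<Sum>i\<in>Basis. D i *\<^sub>R i)"
  have D_eq: "D = (\<lambda>h. h \<bullet> g)"
  proof
    fix h
    have "D h = D (\<Sum>i\<in>Basis. (h \<bullet> i) *\<^sub>R i)"
      by (simp add: euclidean_representation)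
    also have "\<dots> = (\<Sum>i\<in>Basis. (h \<bullet> i) * D i)"
      using bounded_linear.linear[OF lin] by (simp add: linear_sum linear_scale)
    also have "\<dots> = h \<bullet> g"
      unfolding g_def by (simp add: inner_sum_right mult.commute)
    finally show "D h = h \<bullet> g" .
  qed
  have g: "GDERIV f x :> g"
    using D unfolding gderiv_def D_eq .
  have "k = g" if "GDERIV f x :> k" for k
  proof -
    have "(\<lambda>h. h \<bullet> k) = (\<lambda>h. h \<bullet> g)"
      using that g unfolding gderiv_def by (rule has_derivative_unique)
    then have "\<forall>h. h \<bullet> k = h \<bullet> g" by meson
    then show ?thesis by (simp add: vector_eq_ldot)
  qed
  with g show ?thesis
    unfolding gradient_def by (metis theI)
qed

definition smooth :: "real \<Rightarrow> ('a::euclidean_space \<Rightarrow> real) \<Rightarrow> bool" where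
  "smooth L f \<longleftrightarrow>
     (\<forall>x y. f x \<le> f y + gradient f y \<bullet> (x - y) + L / 2 * (norm (x - y))\<^sup>2)"

text \<open>The gradient is taken at \<open>x\<close>, not at \<open>y\<close>; exchanging the two
  variables gives the usual lower quadratic bound.\<close>
definition strongly_convex :: "real \<Rightarrow> ('a::euclidean_space \<Rightarrow> real) \<Rightarrow> bool" where
  "strongly_convex \<mu> f \<longleftrightarrow>
     (\<forall>x y. f x \<le> f y + gradient f x \<bullet> (x - y) - \<mu> / 2 * (norm (x - y))\<^sup>2)"

definition avg :: "nat \<Rightarrow> (nat \<Rightarrow> 'a::euclidean_space \<Rightarrow> real) \<Rightarrow> 'a \<Rightarrow> real" where
  "avg n f x = (1 / real n) * (\<Sum>i=1..n. f i x)"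

text \<open>Vectors of \<open>\<real>\<^sup>n\<close> are functions on \<open>nat\<close> of which only the entries in
  \<open>{1..n}\<close> matter.\<close>
definition sampling_vector :: "nat \<Rightarrow> nat \<Rightarrow> nat set \<Rightarrow> nat \<Rightarrow> real" where
  "sampling_vector n b B = (\<lambda>i. if i \<in> B then real n / real b else 0)"

definition nice_sampling :: "nat \<Rightarrow> nat \<Rightarrow> (nat \<Rightarrow> real) pmf" where
  "nice_sampling n b =
     map_pmf (sampling_vector n b) (pmf_of_set {B. B \<subseteq> {1..n} \<and> card B = b})"

definition sampled_gradient ::
    "nat \<Rightarrow> (nat \<Rightarrow> 'a::euclidean_space \<Rightarrow> real) \<Rightarrow> (nat \<Rightarrow> real) \<Rightarrow> 'a \<Rightarrow> 'a" where
  "sampled_gradient n f v x = (1 / real n) *\<^sub>R (\<Sum>i=1..n. v i *\<^sub>R gradient (f i) x)"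

definition S_sum :: "real \<Rightarrow> real \<Rightarrow> nat \<Rightarrow> real" where
  "S_sum \<alpha> \<mu> m = (\<Sum>i=0..<m. (1 - \<alpha> * \<mu>) ^ (m - 1 - i))"

definition p_weight :: "real \<Rightarrow> real \<Rightarrow> nat \<Rightarrow> nat \<Rightarrow> real" where
  "p_weight \<alpha> \<mu> m t = (1 - \<alpha> * \<mu>) ^ (m - 1 - t) / S_sum \<alpha> \<mu> m"

text \<open>\<open>inner_iter n f \<alpha> w v x t\<close> is the \<open>t\<close>-th iterate of one inner loop started at
  \<open>x\<close> with reference point \<open>w\<close>, where \<open>v t\<close> is the realised sampling vector of step \<open>t\<close>.\<close>
primrec inner_iter ::
    "nat \<Rightarrow> (nat \<Rightarrow> 'a::euclidean_space \<Rightarrow> real) \<Rightarrow> real \<Rightarrow> 'a \<Rightarrow> (nat \<Rightarrow> nat \<Rightarrow> real)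
      \<Rightarrow> 'a \<Rightarrow> nat \<Rightarrow> 'a" where
  "inner_iter n f \<alpha> w v x 0 = x"
| "inner_iter n f \<alpha> w v x (Suc t) =
     (let y = inner_iter n f \<alpha> w v x t;
          g = sampled_gradient n f (v t) y - sampled_gradient n f (v t) w
              + gradient (avg n f) w
      in y - \<alpha> *\<^sub>R g)"

text \<open>\<open>free_svrg n f \<mu> \<alpha> m x\<^sub>0 v s\<close> is the pair of the last inner iterate \<open>x\<^sub>s\<^sup>m\<close> and the
  reference point \<open>w\<^sub>s\<close> along the realisation \<open>v\<close>, where \<open>v s t\<close> is the sampling vector
  drawn at step \<open>t\<close> of outer iteration \<open>s \<ge> 1\<close>.\<close>
primrec free_svrg ::
    "nat \<Rightarrow> (nat \<Rightarrow> 'a::euclidean_space \<Rightarrow> real) \<Rightarrow> real \<Rightarrow> real \<Rightarrow> nat \<Rightarrow> 'a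
      \<Rightarrow> (nat \<Rightarrow> nat \<Rightarrow> nat \<Rightarrow> real) \<Rightarrow> nat \<Rightarrow> 'a \<times> 'a" where
  "free_svrg n f \<mu> \<alpha> m x\<^sub>0 v 0 = (x\<^sub>0, x\<^sub>0)"
| "free_svrg n f \<mu> \<alpha> m x\<^sub>0 v (Suc s) =
     (let (x, w) = free_svrg n f \<mu> \<alpha> m x\<^sub>0 v s;
          y = inner_iter n f \<alpha> w (v (Suc s)) x
      in (y m, \<Sum>t=0..<m. p_weight \<alpha> \<mu> m t *\<^sub>R y t))"

definition exp_residual :: "nat \<Rightarrow> real \<Rightarrow> nat \<Rightarrow> real" where
  "exp_residual n Lmax b =
     1 / real b * ((real n - real b) / (real n - 1)) * Lmax"

definition exp_smoothness :: "nat \<Rightarrow> real \<Rightarrow> real \<Rightarrow> nat \<Rightarrow> real" where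
  "exp_smoothness n Lmax L b =
     1 / real b * ((real n - real b) / (real n - 1)) * Lmax
     + real n / real b * ((real b - 1) / (real n - 1)) * L"

definition total_complexity ::
    "nat \<Rightarrow> real \<Rightarrow> real \<Rightarrow> real \<Rightarrow> real \<Rightarrow> nat \<Rightarrow> nat \<Rightarrow> real" where
  "total_complexity n Lmax L \<mu> \<epsilon> m b =
     2 * (real n / real m + 2 * real b)
       * max ((exp_smoothness n Lmax L b + 2 * exp_residual n Lmax b) / \<mu>) (real m)
       * ln (1 / \<epsilon>)"

end

theory Submission
  imports Defs
begin

text \<open>Write \<open>gap x\<close> for \<open>f x - f xstar\<close>, \<open>q\<close> for \<open>1 - \<alpha> \<mu>\<close> and \<open>S\<close> for the weight sum
  \<open>S_sum \<alpha> \<mu> m\<close>.  The quantity that contracts is the potential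
  \<open>\<parallel>x - xstar\<parallel>\<^sup>2 + 8 \<alpha>\<^sup>2 \<rho> S gap w\<close> of the pair \<open>(x, w)\<close> of last iterate and reference point.

  For fixed \<open>x\<close> and \<open>w\<close> the step direction is an unbiased estimate of \<open>\<nabla>f(x)\<close>.  Writing it as
  the difference of \<open>\<nabla>f_v(x) - \<nabla>f_v(xstar)\<close> and the centred variable
  \<open>\<nabla>f_v(w) - \<nabla>f_v(xstar) - \<nabla>f(w)\<close>, its second moment is at most
  \<open>4 \<L> gap x + 4 \<rho> gap w\<close> (\<open>expected_smoothness\<close>, \<open>expected_residual\<close>).  Both constants come
  from the exact second moment of the mean of a uniformly chosen \<open>b\<close>-subset of vectors
  (\<open>second_moment_uniform_subset\<close>), combined with the bound of squared gradient differences by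
  function values that smoothness and convexity give.  Strong convexity then yields, for one step,
  \<open>E \<parallel>x\<^sup>+ - xstar\<parallel>\<^sup>2 \<le> q \<parallel>x - xstar\<parallel>\<^sup>2 - 2 \<alpha> (1 - 2 \<alpha> \<L>) gap x + 4 \<alpha>\<^sup>2 \<rho> gap w\<close>.

  The step size is the one for which \<open>2 \<alpha> (1 - 2 \<alpha> \<L>) = 8 \<alpha>\<^sup>2 \<rho>\<close>, and \<open>expected_step\<close> states
  the bound in this form.  Unrolling \<open>m\<close> steps gives the
  gaps of the inner iterates the weights \<open>q ^ (m - 1 - t)\<close>, which are \<open>S\<close> times those defining the
  next reference point; by Jensen's inequality the accumulated decrease pays for the whole second
  part of the next potential.  What is left is \<open>q ^ m \<parallel>x - xstar\<parallel>\<^sup>2 + 4 \<alpha>\<^sup>2 \<rho> S gap w\<close>, in which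
  the gap has half of its former coefficient.  So the expected potential shrinks by the factor
  \<open>max (q ^ m) (1 / 2)\<close> (\<open>expected_potential_step\<close>), and the two terms of the maximum in the
  complexity are what makes the \<open>s\<close>-th powers of \<open>q ^ m\<close> and of \<open>1 / 2\<close> at most \<open>\<epsilon>\<close>
  (\<open>rate_power_le\<close>).

  On the probabilistic side, every quantity is a function of finitely many samples with finitely
  many values.  Conditioning on the past is replaced by \<open>expectation_fresh_sample\<close>, which
  integrates out one sample that the rest of the expression does not see.\<close>

section \<open>Smooth and convex functions\<close>

lemma gradient_eqI:
  fixes f :: "'a::euclidean_space \<Rightarrow> real"
  assumes "GDERIV f x :> g"
  shows "gradient f x = g"
proof -
  have "f differentiable (at x)"
    using assms unfolding gderiv_def differentiable_def by blast
  then have "GDERIV f x :> gradient f x"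
    by (rule GDERIV_gradient)
  then have "(\<lambda>h. h \<bullet> gradient f x) = (\<lambda>h. h \<bullet> g)"
    using assms unfolding gderiv_def by (rule has_derivative_unique)
  then have "\<forall>h. h \<bullet> gradient f x = h \<bullet> g"
    by meson
  then show ?thesis
    by (simp add: vector_eq_ldot)
qed

lemma gradient_avg:
  fixes f :: "nat \<Rightarrow> 'a::euclidean_space \<Rightarrow> real"
  assumes "\<And>i. i \<in> {1..n} \<Longrightarrow> f i differentiable (at x)"
  shows "gradient (avg n f) x = (1 / real n) *\<^sub>R (\<Sum>i=1..n. gradient (f i) x)"
proof (rule gradient_eqI)
  have "((\<lambda>x. (1 / real n) * (\<Sum>i=1..n. f i x)) has_derivative
          (\<lambda>h. (1 / real n) * (\<Sum>i=1..n. h \<bullet> gradient (f i) x))) (at x)"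
    using assms GDERIV_gradient
    by (intro has_derivative_mult_right has_derivative_sum) (auto simp: gderiv_def)
  then show "GDERIV (avg n f) x :> (1 / real n) *\<^sub>R (\<Sum>i=1..n. gradient (f i) x)"
    unfolding gderiv_def avg_def[abs_def] by (simp add: inner_sum_right)
qed

lemma convex_above_tangent:
  fixes f :: "'a::euclidean_space \<Rightarrow> real"
  assumes conv: "convex_on UNIV f" and diff: "f differentiable (at x)"
  shows "f x + gradient f x \<bullet> (y - x) \<le> f y"
proof -
  have der: "(f has_derivative (\<lambda>h. h \<bullet> gradient f x)) (at x)"
    using GDERIV_gradient[OF diff] by (simp add: gderiv_def)
  \<comment> \<open>The difference quotients on the segment from \<open>x\<close> to \<open>y\<close> stay below \<open>f y - f x\<close> and tend
    to the directional derivative.\<close>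
  have line: "((\<lambda>t::real. x + t *\<^sub>R (y - x)) has_derivative (\<lambda>t. t *\<^sub>R (y - x))) (at 0)"
    by (auto intro!: derivative_eq_intros)
  have "((\<lambda>t::real. f (x + t *\<^sub>R (y - x))) has_derivative
           (\<lambda>t. (t *\<^sub>R (y - x)) \<bullet> gradient f x)) (at 0)"
    using has_derivative_compose[OF line, of f "\<lambda>h. h \<bullet> gradient f x"] der by simp
  moreover have "(\<lambda>t. (t *\<^sub>R (y - x)) \<bullet> gradient f x) = (*) (gradient f x \<bullet> (y - x))"
    by (simp add: fun_eq_iff inner_commute)
  ultimately have "((\<lambda>t::real. f (x + t *\<^sub>R (y - x))) has_real_derivative
           (gradient f x \<bullet> (y - x))) (at 0)"
    by (simp add: has_field_derivative_def)
  then have "((\<lambda>t. (f (x + t *\<^sub>R (y - x)) - f x) / t) \<longlongrightarrow> gradient f x \<bullet> (y - x)) (at 0)"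
    by (simp add: has_field_derivative_iff)
  then have lim: "((\<lambda>t. (f (x + t *\<^sub>R (y - x)) - f x) / t) \<longlongrightarrow> gradient f x \<bullet> (y - x)) (at_right 0)"
    by (rule tendsto_mono[rotated]) (simp add: at_le)
  have "gradient f x \<bullet> (y - x) \<le> f y - f x"
  proof (rule tendsto_upperbound[OF lim])
    have "\<forall>\<^sub>F t in at_right 0. (0::real) < t \<and> t < 1"
      using eventually_at_right_real[of 0 "1::real"] by simp
    then show "\<forall>\<^sub>F t in at_right 0. (f (x + t *\<^sub>R (y - x)) - f x) / t \<le> f y - f x"
    proof eventually_elim
      case (elim t)
      have "f ((1 - t) *\<^sub>R x + t *\<^sub>R y) \<le> (1 - t) * f x + t * f y"
        using elim by (intro convex_onD[OF conv]) auto
      moreover have "(1 - t) *\<^sub>R x + t *\<^sub>R y = x + t *\<^sub>R (y - x)"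
        by (simp add: algebra_simps)
      ultimately show ?case
        using elim by (simp add: field_simps)
    qed
  qed simp
  then show ?thesis by simp
qed

lemma smooth_mono:
  assumes "smooth L f" and "L \<le> K"
  shows "smooth K f"
  unfolding smooth_def
proof (intro allI)
  fix x y
  have "f x \<le> f y + gradient f y \<bullet> (x - y) + L / 2 * (norm (x - y))\<^sup>2"
    using assms(1) by (simp add: smooth_def)
  also have "L / 2 * (norm (x - y))\<^sup>2 \<le> K / 2 * (norm (x - y))\<^sup>2"
    using assms(2) by (intro mult_right_mono) auto
  finally show "f x \<le> f y + gradient f y \<bullet> (x - y) + K / 2 * (norm (x - y))\<^sup>2"
    by simp
qed

text \<open>This makes \<open>f\<close> also \<open>Lmax\<close>-smooth, from which \<open>\<mu> \<le> Lmax\<close> and hence \<open>Lmax > 0\<close> follow.\<close>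
lemma smooth_avg:
  fixes f :: "nat \<Rightarrow> 'a::euclidean_space \<Rightarrow> real"
  assumes "n \<ge> 1" and "\<And>i x. i \<in> {1..n} \<Longrightarrow> f i differentiable (at x)"
    and "\<And>i. i \<in> {1..n} \<Longrightarrow> smooth K (f i)"
  shows "smooth K (avg n f)"
  unfolding smooth_def
proof (intro allI)
  fix x y
  have grad: "gradient (avg n f) y = (1 / real n) *\<^sub>R (\<Sum>i=1..n. gradient (f i) y)"
    by (rule gradient_avg) (rule assms(2))
  have "(\<Sum>i=1..n. f i x)
      \<le> (\<Sum>i=1..n. f i y + gradient (f i) y \<bullet> (x - y) + K / 2 * (norm (x - y))\<^sup>2)"
    using assms(3) by (intro sum_mono) (auto simp: smooth_def)
  also have "\<dots> = (\<Sum>i=1..n. f i y) + (\<Sum>i=1..n. gradient (f i) y) \<bullet> (x - y)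
      + real n * (K / 2 * (norm (x - y))\<^sup>2)"
    by (simp only: sum.distrib inner_sum_left sum_constant card_atLeastAtMost) simp
  finally show "avg n f x \<le> avg n f y + gradient (avg n f) y \<bullet> (x - y) + K / 2 * (norm (x - y))\<^sup>2"
    unfolding grad using assms(1) by (simp add: avg_def field_simps)
qed

text \<open>Adding the two quadratic bounds at a pair of points cancels values and gradients and leaves
  \<open>\<mu> \<parallel>x - y\<parallel>\<^sup>2 \<le> L \<parallel>x - y\<parallel>\<^sup>2\<close>; a Euclidean space has two points at distance \<open>1\<close>.\<close>
lemma strongly_convex_le_smooth:
  fixes f :: "'a::euclidean_space \<Rightarrow> real"
  assumes "strongly_convex \<mu> f" and "smooth L f"
  shows "\<mu> \<le> L"
proof -
  obtain e :: 'a where e: "e \<in> Basis"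
    using nonempty_Basis by blast
  have "f 0 \<le> f e + gradient f 0 \<bullet> (0 - e) - \<mu> / 2 * (norm (0 - e))\<^sup>2"
    using assms(1) unfolding strongly_convex_def by blast
  moreover have "f e \<le> f 0 + gradient f 0 \<bullet> (e - 0) + L / 2 * (norm (e - 0))\<^sup>2"
    using assms(2) unfolding smooth_def by blast
  ultimately show ?thesis
    using e by (simp add: inner_minus_right)
qed

text \<open>A step of length \<open>1 / L\<close> along the negative gradient lowers \<open>f\<close> by at least
  \<open>\<parallel>\<nabla>f x\<parallel>\<^sup>2 / (2 L)\<close>, and \<open>f\<close> cannot fall below its minimum.  Applied to
  \<open>y \<mapsto> f y - \<nabla>f y\<^sub>0 \<bullet> y\<close>, which a convex \<open>f\<close> makes minimal at \<open>y\<^sub>0\<close>, the same step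
  bounds differences of gradients by Bregman divergences; that form is stated, with \<open>g\<close>
  in the role of \<open>\<nabla>f y\<^sub>0\<close> and \<open>c\<close> in that of the minimum.\<close>
lemma smooth_gradient_gap:
  fixes f :: "'a::euclidean_space \<Rightarrow> real"
  assumes "smooth L f" and "L > 0" and lower: "\<And>z. c \<le> f z - g \<bullet> z"
  shows "(norm (gradient f x - g))\<^sup>2 \<le> 2 * L * (f x - g \<bullet> x - c)"
proof -
  define d where "d = gradient f x - g"
  define z where "z = x - (1 / L) *\<^sub>R d"
  have dz: "z - x = - (1 / L) *\<^sub>R d"
    by (simp add: z_def)
  have "f z \<le> f x + gradient f x \<bullet> (z - x) + L / 2 * (norm (z - x))\<^sup>2"
    using assms(1) unfolding smooth_def by blast
  also have "L / 2 * (norm (z - x))\<^sup>2 = (d \<bullet> d) / (2 * L)"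
    using assms(2) by (simp add: dz power_mult_distrib power2_norm_eq_inner[of d] power2_eq_square[of L] field_simps)
  finally have "c + g \<bullet> z \<le> f x + gradient f x \<bullet> (z - x) + (d \<bullet> d) / (2 * L)"
    using lower[of z] by linarith
  then have "c + g \<bullet> x \<le> f x + d \<bullet> (z - x) + (d \<bullet> d) / (2 * L)"
    by (simp add: d_def inner_diff_left inner_diff_right)
  also have "d \<bullet> (z - x) = - (d \<bullet> d) / L"
    by (simp add: dz)
  finally show ?thesis
    using assms(2) unfolding d_def[symmetric]
    by (simp add: power2_norm_eq_inner field_simps)
qed

corollary smooth_gradient_at_min:
  fixes f :: "'a::euclidean_space \<Rightarrow> real"
  assumes "smooth L f" and "L > 0" and "\<And>z. f y \<le> f z"
  shows "(norm (gradient f x))\<^sup>2 \<le> 2 * L * (f x - f y)"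
  using smooth_gradient_gap[of L f "f y" 0 x] assms by simp

corollary smooth_convex_gradient_diff:
  fixes f :: "'a::euclidean_space \<Rightarrow> real"
  assumes "smooth L f" and "L > 0" and "convex_on UNIV f" and "f differentiable (at y)"
  shows "(norm (gradient f x - gradient f y))\<^sup>2
    \<le> 2 * L * (f x - f y - gradient f y \<bullet> (x - y))"
proof -
  have "f y - gradient f y \<bullet> y \<le> f z - gradient f y \<bullet> z" for z
    using convex_above_tangent[OF assms(3,4), of z] by (simp add: inner_diff_right)
  from smooth_gradient_gap[OF assms(1,2) this] show ?thesis
    by (simp add: inner_diff_right algebra_simps)
qed

section \<open>Moments of the nice sampling\<close>

text \<open>Removing \<open>T\<close> is a bijection onto the \<open>k\<close>-subsets of \<open>A - T\<close>.\<close>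
lemma card_subsets_containing:
  assumes "finite A" and "T \<subseteq> A"
  shows "card {B. B \<subseteq> A \<and> card B = card T + k \<and> T \<subseteq> B} = (card A - card T) choose k"
proof -
  have fin: "finite T" "finite (A - T)"
    using assms finite_subset by auto
  have "bij_betw (\<lambda>C. C \<union> T) {C. C \<subseteq> A - T \<and> card C = k}
      {B. B \<subseteq> A \<and> card B = card T + k \<and> T \<subseteq> B}"
  proof (rule bij_betw_byWitness[where f' = "\<lambda>B. B - T"])
    show "(\<lambda>C. C \<union> T) ` {C. C \<subseteq> A - T \<and> card C = k}
        \<subseteq> {B. B \<subseteq> A \<and> card B = card T + k \<and> T \<subseteq> B}"
    proof clarsimp
      fix C assume C: "C \<subseteq> A - T"
      then have "finite C" "C \<inter> T = {}"
        using fin finite_subset by auto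
      then show "C \<subseteq> A \<and> T \<subseteq> A \<and> card (C \<union> T) = card T + card C"
        using C fin assms by (auto simp: card_Un_disjoint)
    qed
    show "(\<lambda>B. B - T) ` {B. B \<subseteq> A \<and> card B = card T + k \<and> T \<subseteq> B}
        \<subseteq> {C. C \<subseteq> A - T \<and> card C = k}"
      using fin by (auto simp: card_Diff_subset)
  qed auto
  then have "card {B. B \<subseteq> A \<and> card B = card T + k \<and> T \<subseteq> B} = card {C. C \<subseteq> A - T \<and> card C = k}"
    by (simp add: bij_betw_same_card)
  also have "\<dots> = (card A - card T) choose k"
    using fin assms by (simp add: n_subsets card_Diff_subset)
  finally show ?thesis .
qed

abbreviation uniform_subset :: "'i set \<Rightarrow> nat \<Rightarrow> 'i set pmf" where
  "uniform_subset A b \<equiv> pmf_of_set {B. B \<subseteq> A \<and> card B = b}"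

context
  fixes A :: "'i set" and b :: nat
  assumes fin: "finite A" and b: "1 \<le> b" "b \<le> card A"
begin

lemma subsets_of_card: "{B. B \<subseteq> A \<and> card B = b} \<noteq> {}" "finite {B. B \<subseteq> A \<and> card B = b}"
  using fin b obtain_subset_with_card_n[of b A] by auto

lemma set_pmf_uniform_subset: "set_pmf (uniform_subset A b) = {B. B \<subseteq> A \<and> card B = b}"
  by (rule set_pmf_of_set[OF subsets_of_card])

lemma integrable_uniform_subset [simp]:
  fixes h :: "'i set \<Rightarrow> real"
  shows "integrable (uniform_subset A b) h"
  by (rule integrable_measure_pmf_finite) (simp add: set_pmf_uniform_subset fin)

lemma expectation_uniform_subset_of_bool:
  "measure_pmf.expectation (uniform_subset A b) (\<lambda>B. of_bool (P B))
    = real (card {B. B \<subseteq> A \<and> card B = b \<and> P B}) / real (card A choose b)"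
proof -
  have "{B. B \<subseteq> A \<and> card B = b} \<inter> {B. P B} = {B. B \<subseteq> A \<and> card B = b \<and> P B}"
    by auto
  then show ?thesis
    unfolding integral_pmf_of_set[OF subsets_of_card] n_subsets[OF fin] of_bool_def
    by (simp add: sum.If_cases fin)
qed

lemma inclusion_probability:
  assumes "i \<in> A"
  shows "measure_pmf.expectation (uniform_subset A b) (\<lambda>B. of_bool (i \<in> B))
    = real b / real (card A)"
proof -
  obtain k where k: "b = Suc k"
    using b by (cases b) auto
  have "card {B. B \<subseteq> A \<and> card B = b \<and> i \<in> B} = (card A - 1) choose k"
    using card_subsets_containing[OF fin, of "{i}" k] assms by (simp add: k)
  moreover have "real b * real (card A choose b) = real (card A) * real ((card A - 1) choose k)"
    using binomial_absorption[of k "card A"] unfolding k by (metis of_nat_mult)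
  moreover have "real (card A) > 0" "real (card A choose b) > 0"
    using b by auto
  ultimately show ?thesis
    unfolding expectation_uniform_subset_of_bool by (simp add: field_simps)
qed

text \<open>The absorption identity, used twice, reduces \<open>card A choose b\<close> to the number
  \<open>(card A - 2) choose (b - 2)\<close> of subsets through both points.  For \<open>b = 1\<close> there are none,
  and the formula vanishes through its factor \<open>b - 1\<close>.\<close>
lemma pair_inclusion_probability:
  assumes "i \<in> A" "j \<in> A" "i \<noteq> j"
  shows "measure_pmf.expectation (uniform_subset A b) (\<lambda>B. of_bool (i \<in> B \<and> j \<in> B))
    = (real b * (real b - 1)) / (real (card A) * (real (card A) - 1))"
proof -
  have two: "card {i, j} = 2" "card {i, j} \<le> card A"
    using assms fin card_mono[of A "{i, j}"] by auto
  show ?thesis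
  proof (cases "b = 1")
    case True
    have "{B. B \<subseteq> A \<and> card B = b \<and> (i \<in> B \<and> j \<in> B)} = {}"
      using assms True by (auto simp: card_1_singleton_iff)
    then show ?thesis
      unfolding expectation_uniform_subset_of_bool using True by (simp only: card.empty) simp
  next
    case False
    then have "2 \<le> b"
      using b by linarith
    then obtain k where k: "b = Suc (Suc k)"
      using le_Suc_ex[of 2 b] by auto
    let ?n = "card A"
    have card: "card {B. B \<subseteq> A \<and> card B = b \<and> (i \<in> B \<and> j \<in> B)} = (?n - 2) choose k"
      using card_subsets_containing[OF fin, of "{i, j}" k] assms two(1) by (simp add: k)
    have "real b * real (?n choose b) = real ?n * real ((?n - 1) choose Suc k)"
      using binomial_absorption[of "Suc k" ?n] unfolding k by (metis of_nat_mult)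
    moreover have "real (Suc k) * real ((?n - 1) choose Suc k) = real (?n - 1) * real ((?n - 2) choose k)"
      using arg_cong[OF binomial_absorption[of k "?n - 1"], of real]
      by (simp only: of_nat_mult diff_diff_left nat_1_add_1)
    ultimately have "real b * real (Suc k) * real (?n choose b)
        = real ?n * real (?n - 1) * real ((?n - 2) choose k)"
      by algebra
    moreover have "real (Suc k) = real b - 1" "real (?n - 1) = real ?n - 1"
      using two by (auto simp: k of_nat_diff)
    ultimately have "real b * (real b - 1) * real (?n choose b)
        = real ?n * (real ?n - 1) * real ((?n - 2) choose k)"
      by (simp only:)
    moreover have "real ?n > 0" "real ?n - 1 > 0" "real (?n choose b) > 0"
      using b two by auto
    ultimately show ?thesis
      unfolding expectation_uniform_subset_of_bool card
      by (subst frac_eq_eq) (simp_all add: mult_ac)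
  qed
qed

lemma sum_subset_eq_of_bool:
  fixes c :: "'i \<Rightarrow> real"
  assumes "B \<subseteq> A"
  shows "(\<Sum>i\<in>B. c i) = (\<Sum>i\<in>A. of_bool (i \<in> B) * c i)"
  using assms fin by (intro sum.mono_neutral_cong_left) auto

lemma expectation_uniform_subset_cong:
  fixes h k :: "'i set \<Rightarrow> real"
  assumes "\<And>B. B \<subseteq> A \<Longrightarrow> card B = b \<Longrightarrow> h B = k B"
  shows "measure_pmf.expectation (uniform_subset A b) h
    = measure_pmf.expectation (uniform_subset A b) k"
  unfolding integral_pmf_of_set[OF subsets_of_card]
  using assms by (intro arg_cong2[where f = "(/)"] sum.cong) auto

lemma expectation_sum_uniform_subset:
  fixes c :: "'i \<Rightarrow> real"
  shows "measure_pmf.expectation (uniform_subset A b) (\<lambda>B. \<Sum>i\<in>B. c i)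
    = real b / real (card A) * (\<Sum>i\<in>A. c i)"
proof -
  have "measure_pmf.expectation (uniform_subset A b) (\<lambda>B. \<Sum>i\<in>B. c i)
      = measure_pmf.expectation (uniform_subset A b) (\<lambda>B. \<Sum>i\<in>A. of_bool (i \<in> B) * c i)"
    by (rule expectation_uniform_subset_cong) (rule sum_subset_eq_of_bool)
  also have "\<dots> = (\<Sum>i\<in>A. measure_pmf.expectation (uniform_subset A b) (\<lambda>B. of_bool (i \<in> B)) * c i)"
    by (subst Bochner_Integration.integral_sum) auto
  also have "\<dots> = (\<Sum>i\<in>A. real b / real (card A) * c i)"
    by (intro sum.cong) (simp_all add: inclusion_probability)
  finally show ?thesis
    by (simp add: sum_distrib_left)
qed

lemma expectation_double_sum_uniform_subset:
  fixes c :: "'i \<Rightarrow> 'i \<Rightarrow> real"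
  shows "measure_pmf.expectation (uniform_subset A b) (\<lambda>B. \<Sum>i\<in>B. \<Sum>j\<in>B. c i j)
    = real b / real (card A) * (\<Sum>i\<in>A. c i i)
      + (real b * (real b - 1)) / (real (card A) * (real (card A) - 1))
        * ((\<Sum>i\<in>A. \<Sum>j\<in>A. c i j) - (\<Sum>i\<in>A. c i i))"
    (is "?E = ?p * _ + ?q * _")
proof -
  have "?E = measure_pmf.expectation (uniform_subset A b)
      (\<lambda>B. \<Sum>i\<in>A. \<Sum>j\<in>A. of_bool (i \<in> B \<and> j \<in> B) * c i j)"
  proof (rule expectation_uniform_subset_cong)
    fix B assume B: "B \<subseteq> A"
    show "(\<Sum>i\<in>B. \<Sum>j\<in>B. c i j) = (\<Sum>i\<in>A. \<Sum>j\<in>A. of_bool (i \<in> B \<and> j \<in> B) * c i j)"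
      by (simp only: sum_subset_eq_of_bool[OF B] sum_distrib_left of_bool_conj mult.assoc)
  qed
  also have "\<dots> = (\<Sum>i\<in>A. \<Sum>j\<in>A.
      measure_pmf.expectation (uniform_subset A b) (\<lambda>B. of_bool (i \<in> B \<and> j \<in> B)) * c i j)"
    by (subst Bochner_Integration.integral_sum, simp,
        intro sum.cong refl, subst Bochner_Integration.integral_sum) auto
  also have "\<dots> = (\<Sum>i\<in>A. \<Sum>j\<in>A. ?q * c i j + (if j = i then (?p - ?q) * c i i else 0))"
  proof (intro sum.cong refl)
    fix i j assume "i \<in> A" "j \<in> A"
    then show "measure_pmf.expectation (uniform_subset A b) (\<lambda>B. of_bool (i \<in> B \<and> j \<in> B)) * c i j
        = ?q * c i j + (if j = i then (?p - ?q) * c i i else 0)"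
      by (cases "i = j") (auto simp: inclusion_probability pair_inclusion_probability algebra_simps)
  qed
  also have "\<dots> = ?q * (\<Sum>i\<in>A. \<Sum>j\<in>A. c i j) + (?p - ?q) * (\<Sum>i\<in>A. c i i)"
    using fin by (simp add: sum.distrib sum_distrib_left)
  also have "\<dots> = ?p * (\<Sum>i\<in>A. c i i) + ?q * ((\<Sum>i\<in>A. \<Sum>j\<in>A. c i j) - (\<Sum>i\<in>A. c i i))"
    by (simp only: left_diff_distrib right_diff_distrib)
  finally show ?thesis .
qed

text \<open>Expanding the square gives a double sum of inner products; its diagonal terms carry the
  inclusion probability of one index, the others that of a pair.\<close>
lemma second_moment_uniform_subset:
  fixes a :: "'i \<Rightarrow> 'a::euclidean_space"
  assumes "card A \<ge> 2"
  shows "measure_pmf.expectation (uniform_subset A b) (\<lambda>B. (norm ((1 / real b) *\<^sub>R (\<Sum>i\<in>B. a i)))\<^sup>2)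
    = 1 / real b * ((real (card A) - real b) / (real (card A) - 1))
        * ((\<Sum>i\<in>A. (norm (a i))\<^sup>2) / real (card A))
      + real (card A) / real b * ((real b - 1) / (real (card A) - 1))
        * (norm ((1 / real (card A)) *\<^sub>R (\<Sum>i\<in>A. a i)))\<^sup>2"
proof -
  have square: "(norm (c *\<^sub>R (\<Sum>i\<in>B. a i)))\<^sup>2 = c\<^sup>2 * (\<Sum>i\<in>B. \<Sum>j\<in>B. a i \<bullet> a j)" for c B
  proof -
    have "(\<Sum>i\<in>B. a i) \<bullet> (\<Sum>i\<in>B. a i) = (\<Sum>i\<in>B. a i \<bullet> (\<Sum>j\<in>B. a j))"
      by (rule inner_sum_left)
    also have "\<dots> = (\<Sum>i\<in>B. \<Sum>j\<in>B. a i \<bullet> a j)"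
      by (simp only: inner_sum_right)
    finally show ?thesis
      by (simp add: power_mult_distrib power2_norm_eq_inner[of "sum _ _"])
  qed
  have algebra: "(1 / \<beta>)\<^sup>2 * (\<beta> / N * D + \<beta> * (\<beta> - 1) / (N * (N - 1)) * (S - D))
      = 1 / \<beta> * ((N - \<beta>) / (N - 1)) * (D / N) + N / \<beta> * ((\<beta> - 1) / (N - 1)) * ((1 / N)\<^sup>2 * S)"
    if "\<beta> > 0" "N > 1" for \<beta> N D S :: real
  proof -
    have "N - 1 > 0" "N > 0" using that by auto
    then show ?thesis
      using that(1) by (simp add: divide_simps power2_eq_square) (simp add: algebra_simps)
  qed
  show ?thesis
    unfolding square using b assms
    by (simp only: integral_mult_right_zero expectation_double_sum_uniform_subset
        power2_norm_eq_inner) (rule algebra, auto)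
qed

end

section \<open>One step of Free-SVRG\<close>

locale svrg_problem =
  fixes n b :: nat
    and f :: "nat \<Rightarrow> 'a::euclidean_space \<Rightarrow> real"
    and L Lmax \<mu> \<alpha> :: real
    and xstar :: 'a
  assumes n: "2 \<le> n"
    and diff: "\<And>i x. i \<in> {1..n} \<Longrightarrow> f i differentiable (at x)"
    and conv: "\<And>i. i \<in> {1..n} \<Longrightarrow> convex_on UNIV (f i)"
    and smooth_summand: "\<And>i. i \<in> {1..n} \<Longrightarrow> smooth Lmax (f i)"
    and smooth_avg_L: "smooth L (avg n f)"
    and mu: "0 < \<mu>"
    and sconv: "strongly_convex \<mu> (avg n f)"
    and minimal: "\<And>x. avg n f xstar \<le> avg n f x"
    and b: "b \<in> {1..n}"
    and alpha: "\<alpha> = 1 / (2 * (exp_smoothness n Lmax L b + 2 * exp_residual n Lmax b))"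
begin

abbreviation gap :: "'a \<Rightarrow> real" where
  "gap x \<equiv> avg n f x - avg n f xstar"

abbreviation \<L> :: real where
  "\<L> \<equiv> exp_smoothness n Lmax L b"

abbreviation \<rho> :: real where
  "\<rho> \<equiv> exp_residual n Lmax b"

lemma gap_nonneg: "0 \<le> gap x"
  using minimal[of x] by simp

lemma mu_le_L: "\<mu> \<le> L"
  by (rule strongly_convex_le_smooth[OF sconv smooth_avg_L])

lemma mu_le_Lmax: "\<mu> \<le> Lmax"
  using strongly_convex_le_smooth[OF sconv smooth_avg] n diff smooth_summand by simp

text \<open>The coefficients of \<open>Lmax\<close> and \<open>L\<close> in \<open>\<L>\<close> are nonnegative and add up to \<open>1\<close>.\<close>
lemma mu_le_exp_smoothness: "\<mu> \<le> \<L>"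
proof -
  let ?p = "1 / real b * ((real n - real b) / (real n - 1))"
  let ?q = "real n / real b * ((real b - 1) / (real n - 1))"
  have pos: "real b > 0" "real n - 1 > 0"
    using n b by auto
  have "?p \<ge> 0" "?q \<ge> 0"
    using n b by (auto intro!: mult_nonneg_nonneg divide_nonneg_nonneg)
  moreover have one: "?p + ?q = 1"
    using pos by (simp add: divide_simps) (simp add: algebra_simps)
  moreover have "\<mu> = (?p + ?q) * \<mu>"
    by (simp only: one mult_1_left)
  ultimately have "\<mu> \<le> ?p * Lmax + ?q * L"
    using mu_le_L mu_le_Lmax by (metis (no_types, lifting) add_mono distrib_right mult_left_mono)
  then show ?thesis
    by (simp add: exp_smoothness_def)
qed

lemma exp_residual_nonneg: "0 \<le> \<rho>"
  unfolding exp_residual_def using n b mu mu_le_Lmax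
  by (auto intro!: mult_nonneg_nonneg divide_nonneg_nonneg)

lemma alpha_pos: "0 < \<alpha>"
  using mu mu_le_exp_smoothness exp_residual_nonneg by (simp add: alpha)

lemma alpha_eq: "2 * \<alpha> * (\<L> + 2 * \<rho>) = 1"
  using mu mu_le_exp_smoothness exp_residual_nonneg by (simp add: alpha)

text \<open>The weights \<open>(1 - \<alpha> * \<mu>) ^ k\<close> of the inner iterates are therefore positive.\<close>
lemma alpha_mu_le_half: "\<alpha> * \<mu> \<le> 1 / 2"
proof -
  have "\<alpha> * \<mu> \<le> \<alpha> * (\<L> + 2 * \<rho>)"
    using alpha_pos mu_le_exp_smoothness exp_residual_nonneg by (intro mult_left_mono) auto
  then show ?thesis
    using alpha_eq by simp
qed

lemma gradient_min: "gradient (avg n f) xstar = 0"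
  using smooth_gradient_at_min[OF smooth_avg_L _ minimal, of xstar] mu mu_le_L by simp

lemma gradient_avg_eq: "gradient (avg n f) x = (1 / real n) *\<^sub>R (\<Sum>i=1..n. gradient (f i) x)"
  by (rule gradient_avg) (rule diff)

lemma sum_gradient_min: "(\<Sum>i=1..n. gradient (f i) xstar) = 0"
  using gradient_min n by (simp add: gradient_avg_eq)

abbreviation sampling_expectation :: "((nat \<Rightarrow> real) \<Rightarrow> real) \<Rightarrow> real" where
  "sampling_expectation h \<equiv> measure_pmf.expectation (nice_sampling n b) h"

lemma subsets: "finite {1..n}" "1 \<le> b" "b \<le> card {1..n}"
  using b by auto

lemma set_nice_sampling:
  "set_pmf (nice_sampling n b) = sampling_vector n b ` {B. B \<subseteq> {1..n} \<and> card B = b}"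
  unfolding nice_sampling_def set_map_pmf set_pmf_uniform_subset[OF subsets] ..

lemma finite_nice_sampling: "finite (set_pmf (nice_sampling n b))"
  by (simp add: set_nice_sampling)

lemma integrable_nice_sampling [simp]:
  fixes h :: "(nat \<Rightarrow> real) \<Rightarrow> real"
  shows "integrable (nice_sampling n b) h"
  by (rule integrable_measure_pmf_finite[OF finite_nice_sampling])

lemma sampling_expectation_eqI:
  assumes "\<And>B. B \<subseteq> {1..n} \<Longrightarrow> h (sampling_vector n b B) = k B"
  shows "sampling_expectation h = measure_pmf.expectation (uniform_subset {1..n} b) k"
  unfolding nice_sampling_def integral_map_pmf
  by (rule expectation_uniform_subset_cong[OF subsets assms])

lemma sampled_gradient_sampling_vector:
  assumes "B \<subseteq> {1..n}"
  shows "sampled_gradient n f (sampling_vector n b B) x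
    = (1 / real b) *\<^sub>R (\<Sum>i\<in>B. gradient (f i) x)"
proof -
  have "(\<Sum>i=1..n. sampling_vector n b B i *\<^sub>R gradient (f i) x)
      = (\<Sum>i\<in>B. (real n / real b) *\<^sub>R gradient (f i) x)"
    using assms by (intro sum.mono_neutral_cong_right) (auto simp: sampling_vector_def)
  then show ?thesis
    using n by (simp add: sampled_gradient_def flip: scaleR_sum_right)
qed

lemma sampled_gradient_unbiased:
  "sampling_expectation (\<lambda>u. sampled_gradient n f u x \<bullet> z) = gradient (avg n f) x \<bullet> z"
proof -
  have "sampling_expectation (\<lambda>u. sampled_gradient n f u x \<bullet> z)
      = measure_pmf.expectation (uniform_subset {1..n} b)
          (\<lambda>B. (1 / real b) * (\<Sum>i\<in>B. gradient (f i) x \<bullet> z))"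
    by (rule sampling_expectation_eqI) (simp add: sampled_gradient_sampling_vector inner_sum_left)
  also have "\<dots> = (1 / real b) * (real b / real n * (\<Sum>i=1..n. gradient (f i) x \<bullet> z))"
    by (simp only: integral_mult_right_zero expectation_sum_uniform_subset[OF subsets]) simp
  finally show ?thesis
    using b by (simp add: gradient_avg_eq inner_sum_left)
qed

text \<open>Summing the Bregman bounds of the \<open>f i\<close> at \<open>xstar\<close>: their linear terms add up to
  \<open>n \<nabla>f(xstar) \<bullet> (x - xstar) = 0\<close>.\<close>
lemma sum_gradient_diff_le:
  "(\<Sum>i=1..n. (norm (gradient (f i) x - gradient (f i) xstar))\<^sup>2) / real n \<le> 2 * Lmax * gap x"
proof -
  have "(\<Sum>i=1..n. (norm (gradient (f i) x - gradient (f i) xstar))\<^sup>2)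
      \<le> (\<Sum>i=1..n. 2 * Lmax * (f i x - f i xstar - gradient (f i) xstar \<bullet> (x - xstar)))"
    using mu mu_le_Lmax by (intro sum_mono smooth_convex_gradient_diff smooth_summand conv diff) auto
  also have "\<dots> = 2 * Lmax * ((\<Sum>i=1..n. f i x) - (\<Sum>i=1..n. f i xstar)
      - (\<Sum>i=1..n. gradient (f i) xstar) \<bullet> (x - xstar))"
    by (simp only: sum_subtractf inner_sum_left flip: sum_distrib_left)
  also have "\<dots> = 2 * Lmax * (real n * gap x)"
    unfolding sum_gradient_min using n by (simp add: avg_def field_simps)
  finally show ?thesis
    using n by (simp add: field_simps)
qed

lemma sampled_gradient_second_moment:
  "sampling_expectation (\<lambda>u. (norm (sampled_gradient n f u x - sampled_gradient n f u xstar))\<^sup>2)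
    = 1 / real b * ((real n - real b) / (real n - 1))
        * ((\<Sum>i=1..n. (norm (gradient (f i) x - gradient (f i) xstar))\<^sup>2) / real n)
      + real n / real b * ((real b - 1) / (real n - 1)) * (norm (gradient (avg n f) x))\<^sup>2"
proof -
  have "sampling_expectation (\<lambda>u. (norm (sampled_gradient n f u x - sampled_gradient n f u xstar))\<^sup>2)
      = measure_pmf.expectation (uniform_subset {1..n} b)
          (\<lambda>B. (norm ((1 / real b) *\<^sub>R (\<Sum>i\<in>B. gradient (f i) x - gradient (f i) xstar)))\<^sup>2)"
    by (rule sampling_expectation_eqI)
       (simp only: sampled_gradient_sampling_vector sum_subtractf scaleR_diff_right)
  moreover have "(1 / real n) *\<^sub>R (\<Sum>i=1..n. gradient (f i) x - gradient (f i) xstar)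
      = gradient (avg n f) x"
    by (simp only: sum_subtractf sum_gradient_min gradient_avg_eq) simp
  ultimately show ?thesis
    using second_moment_uniform_subset[OF subsets,
      of "\<lambda>i. gradient (f i) x - gradient (f i) xstar"] n
    by simp
qed

text \<open>Each of the two terms of the second moment turns into a function value: the mean of the
  squared differences through \<open>Lmax\<close>, the square of the mean through \<open>L\<close>.\<close>
lemma expected_smoothness:
  "sampling_expectation (\<lambda>u. (norm (sampled_gradient n f u x - sampled_gradient n f u xstar))\<^sup>2)
    \<le> 2 * \<L> * gap x"
proof -
  have "(norm (gradient (avg n f) x))\<^sup>2 \<le> 2 * L * gap x"
    using smooth_gradient_at_min[OF smooth_avg_L _ minimal] mu mu_le_L by simp
  then have "real n / real b * ((real b - 1) / (real n - 1)) * (norm (gradient (avg n f) x))\<^sup>2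
      \<le> real n / real b * ((real b - 1) / (real n - 1)) * (2 * L * gap x)"
    using n b by (intro mult_left_mono) auto
  moreover have "1 / real b * ((real n - real b) / (real n - 1))
        * ((\<Sum>i=1..n. (norm (gradient (f i) x - gradient (f i) xstar))\<^sup>2) / real n)
      \<le> 1 / real b * ((real n - real b) / (real n - 1)) * (2 * Lmax * gap x)"
    using n b sum_gradient_diff_le by (intro mult_left_mono) auto
  ultimately show ?thesis
    unfolding sampled_gradient_second_moment exp_smoothness_def by argo
qed

text \<open>The mean \<open>\<nabla>f(w)\<close> of the sampled difference is subtracted here.  This changes the
  coefficient of \<open>\<parallel>\<nabla>f(w)\<parallel>\<^sup>2\<close> in the second moment from \<open>n(b-1)/(b(n-1))\<close> to
  \<open>-(n-b)/(b(n-1)) \<le> 0\<close>, so that only the \<open>Lmax\<close> term remains.\<close>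
lemma expected_residual:
  "sampling_expectation (\<lambda>u. (norm (sampled_gradient n f u w - sampled_gradient n f u xstar
      - gradient (avg n f) w))\<^sup>2) \<le> 2 * \<rho> * gap w"
proof -
  let ?D = "\<lambda>u. sampled_gradient n f u w - sampled_gradient n f u xstar"
  let ?g = "gradient (avg n f) w"
  let ?p = "1 / real b * ((real n - real b) / (real n - 1))"
  let ?q = "real n / real b * ((real b - 1) / (real n - 1))"
  let ?V = "(\<Sum>i=1..n. (norm (gradient (f i) w - gradient (f i) xstar))\<^sup>2) / real n"
  have "sampling_expectation (\<lambda>u. (norm (?D u - ?g))\<^sup>2)
      = sampling_expectation (\<lambda>u. (norm (?D u))\<^sup>2 - 2 * (sampled_gradient n f u w \<bullet> ?g
          - sampled_gradient n f u xstar \<bullet> ?g) + (norm ?g)\<^sup>2)"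
    by (simp add: power2_norm_eq_inner inner_diff_left inner_diff_right inner_commute algebra_simps)
  also have "\<dots> = sampling_expectation (\<lambda>u. (norm (?D u))\<^sup>2) - (norm ?g)\<^sup>2"
    by (simp add: sampled_gradient_unbiased gradient_min power2_norm_eq_inner)
  also have "\<dots> = ?p * ?V + (?q - 1) * (norm ?g)\<^sup>2"
    unfolding sampled_gradient_second_moment by argo
  also have "\<dots> \<le> ?p * ?V"
  proof -
    have "real b > 0" "real n - 1 > 0" "real b \<le> real n"
      using n b by auto
    then have "?q \<le> 1"
      by (simp add: divide_simps) (simp add: algebra_simps)
    then show ?thesis
      by (simp add: mult_nonpos_nonneg)
  qed
  also have "\<dots> \<le> ?p * (2 * Lmax * gap w)"
    using n b sum_gradient_diff_le by (intro mult_left_mono) auto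
  also have "\<dots> = 2 * \<rho> * gap w"
    by (simp only: exp_residual_def mult_ac)
  finally show ?thesis .
qed

definition svrg_direction :: "'a \<Rightarrow> (nat \<Rightarrow> real) \<Rightarrow> 'a \<Rightarrow> 'a" where
  "svrg_direction w u x = sampled_gradient n f u x - sampled_gradient n f u w + gradient (avg n f) w"

lemma svrg_direction_unbiased:
  "sampling_expectation (\<lambda>u. svrg_direction w u x \<bullet> z) = gradient (avg n f) x \<bullet> z"
  by (simp add: svrg_direction_def inner_add_left inner_diff_left sampled_gradient_unbiased)

lemma svrg_direction_second_moment:
  "sampling_expectation (\<lambda>u. (norm (svrg_direction w u x))\<^sup>2) \<le> 4 * \<L> * gap x + 4 * \<rho> * gap w"
proof -
  let ?D = "\<lambda>y u. sampled_gradient n f u y - sampled_gradient n f u xstar"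
  let ?g = "gradient (avg n f) w"
  have "sampling_expectation (\<lambda>u. (norm (svrg_direction w u x))\<^sup>2)
      \<le> sampling_expectation (\<lambda>u. 2 * (norm (?D x u))\<^sup>2 + 2 * (norm (?D w u - ?g))\<^sup>2)"
  proof (rule integral_mono)
    fix u
    have "svrg_direction w u x = ?D x u - (?D w u - ?g)"
      by (simp add: svrg_direction_def)
    moreover have "(norm (p - q))\<^sup>2 \<le> 2 * (norm p)\<^sup>2 + 2 * (norm q)\<^sup>2" for p q :: 'a
    proof -
      have "0 \<le> (norm (p + q))\<^sup>2" by simp
      then show ?thesis
        by (simp add: power2_norm_eq_inner inner_add_left inner_add_right inner_diff_left
          inner_diff_right inner_commute)
    qed
    ultimately show "(norm (svrg_direction w u x))\<^sup>2 \<le> 2 * (norm (?D x u))\<^sup>2 + 2 * (norm (?D w u - ?g))\<^sup>2"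
      by (simp only:)
  qed simp_all
  also have "\<dots> \<le> 2 * (2 * \<L> * gap x) + 2 * (2 * \<rho> * gap w)"
    using expected_smoothness[of x] expected_residual[of w]
    by (subst Bochner_Integration.integral_add) simp_all
  finally show ?thesis by simp
qed

text \<open>The step size turns the coefficient \<open>2 * \<alpha> * (1 - 2 * \<alpha> * \<L>)\<close> of the gap at \<open>x\<close> into
  twice that of the gap at \<open>w\<close>; this factor two is the contraction of the reference part of the
  potential.\<close>
lemma expected_step:
  "sampling_expectation (\<lambda>u. (norm (x - \<alpha> *\<^sub>R svrg_direction w u x - xstar))\<^sup>2)
    \<le> (1 - \<alpha> * \<mu>) * (norm (x - xstar))\<^sup>2 - 8 * \<alpha>\<^sup>2 * \<rho> * gap x + 4 * \<alpha>\<^sup>2 * \<rho> * gap w"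
proof -
  let ?d = "x - xstar"
  have "sampling_expectation (\<lambda>u. (norm (x - \<alpha> *\<^sub>R svrg_direction w u x - xstar))\<^sup>2)
      = sampling_expectation (\<lambda>u. (norm ?d)\<^sup>2 - 2 * \<alpha> * (svrg_direction w u x \<bullet> ?d)
          + \<alpha>\<^sup>2 * (norm (svrg_direction w u x))\<^sup>2)"
  proof (rule Bochner_Integration.integral_cong[OF refl])
    fix u
    have "x - \<alpha> *\<^sub>R svrg_direction w u x - xstar = ?d - \<alpha> *\<^sub>R svrg_direction w u x"
      by simp
    then show "(norm (x - \<alpha> *\<^sub>R svrg_direction w u x - xstar))\<^sup>2
        = (norm ?d)\<^sup>2 - 2 * \<alpha> * (svrg_direction w u x \<bullet> ?d) + \<alpha>\<^sup>2 * (norm (svrg_direction w u x))\<^sup>2"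
      by (simp only: power2_norm_eq_inner)
         (simp add: inner_diff_left[of ?d] inner_diff_right[of _ ?d] inner_commute power2_eq_square)
  qed
  also have "\<dots> = (norm ?d)\<^sup>2 - 2 * \<alpha> * (gradient (avg n f) x \<bullet> ?d)
      + \<alpha>\<^sup>2 * sampling_expectation (\<lambda>u. (norm (svrg_direction w u x))\<^sup>2)"
    by (simp add: svrg_direction_unbiased)
  also have "\<dots> \<le> (norm ?d)\<^sup>2 - 2 * \<alpha> * (gap x + \<mu> / 2 * (norm ?d)\<^sup>2)
      + \<alpha>\<^sup>2 * (4 * \<L> * gap x + 4 * \<rho> * gap w)"
  proof -
    have "gap x + \<mu> / 2 * (norm ?d)\<^sup>2 \<le> gradient (avg n f) x \<bullet> ?d"
      using sconv unfolding strongly_convex_def by (metis add.commute diff_le_eq le_diff_eq add_diff_eq diff_diff_eq2)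
    then have "2 * \<alpha> * (gap x + \<mu> / 2 * (norm ?d)\<^sup>2) \<le> 2 * \<alpha> * (gradient (avg n f) x \<bullet> ?d)"
      using alpha_pos by (intro mult_left_mono) auto
    moreover have "\<alpha>\<^sup>2 * sampling_expectation (\<lambda>u. (norm (svrg_direction w u x))\<^sup>2)
        \<le> \<alpha>\<^sup>2 * (4 * \<L> * gap x + 4 * \<rho> * gap w)"
      by (intro mult_left_mono svrg_direction_second_moment) simp
    ultimately show ?thesis by linarith
  qed
  also have "\<dots> = (1 - \<alpha> * \<mu>) * (norm ?d)\<^sup>2 - 2 * \<alpha> * (1 - 2 * \<alpha> * \<L>) * gap x + 4 * \<alpha>\<^sup>2 * \<rho> * gap w"
    by (simp add: power2_eq_square[of \<alpha>] algebra_simps)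
  also have "1 - 2 * \<alpha> * \<L> = 4 * \<alpha> * \<rho>"
    using alpha_eq by (simp add: algebra_simps)
  finally show ?thesis
    by (simp add: power2_eq_square[of \<alpha>] algebra_simps)
qed

end

section \<open>Expectations along independent samples\<close>

text \<open>Stating which samples a quantity depends on takes the place of measurability with respect
  to the sigma-algebra that they generate.\<close>
definition depends_on :: "'i set \<Rightarrow> (('i \<Rightarrow> 'a) \<Rightarrow> 'b) \<Rightarrow> bool" where
  "depends_on J F \<longleftrightarrow> (\<forall>u u'. (\<forall>k\<in>J. u k = u' k) \<longrightarrow> F u = F u')"

lemma depends_on_compose: "depends_on J F \<Longrightarrow> depends_on J (\<lambda>u. h (F u))"
  unfolding depends_on_def by metis

lemma depends_on_restrict: "depends_on J F \<Longrightarrow> F (restrict u J) = F u"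
  unfolding depends_on_def by simp

text \<open>The samples take values in the finite support everywhere, not only almost surely.  Tuples of
  finitely many samples then lie in a finite space in which every set is measurable, so that every
  function of them is measurable and bounded.  With values in an uncountable space a function of
  two samples that are measurable into the full power set need not be measurable.\<close>
locale independent_samples = prob_space M for M :: "'w measure" +
  fixes X :: "'i \<Rightarrow> 'w \<Rightarrow> 'a" and I :: "'i set" and p :: "'a pmf"
  assumes finite_support: "finite (set_pmf p)"
    and indep: "indep_vars (\<lambda>_. count_space (set_pmf p)) X I"
    and law: "\<And>k a. k \<in> I \<Longrightarrow> a \<in> set_pmf p \<Longrightarrow> prob {\<omega> \<in> space M. X k \<omega> = a} = pmf p a"
begin

abbreviation sample_expectation :: "(('i \<Rightarrow> 'a) \<Rightarrow> real) \<Rightarrow> real" where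
  "sample_expectation F \<equiv> expectation (\<lambda>\<omega>. F (\<lambda>k. X k \<omega>))"

lemma measurable_sample: "k \<in> I \<Longrightarrow> X k \<in> measurable M (count_space (set_pmf p))"
  using indep by (simp add: indep_vars_def)

lemma sample_in_support: "k \<in> I \<Longrightarrow> \<omega> \<in> space M \<Longrightarrow> X k \<omega> \<in> set_pmf p"
  using measurable_space[OF measurable_sample] by simp

lemma PiM_samples:
  "finite J \<Longrightarrow> PiM J (\<lambda>_. count_space (set_pmf p)) = count_space (J \<rightarrow>\<^sub>E set_pmf p)"
  using finite_support by (intro count_space_PiM_finite) (auto simp: countable_finite)

lemma integrable_sample [intro]:
  fixes F :: "('i \<Rightarrow> 'a) \<Rightarrow> real"
  assumes F: "depends_on J F" and J: "finite J" "J \<subseteq> I"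
  shows "integrable M (\<lambda>\<omega>. F (\<lambda>k. X k \<omega>))"
proof -
  let ?R = "\<lambda>\<omega>. restrict (\<lambda>k. X k \<omega>) J"
  have fin: "finite (J \<rightarrow>\<^sub>E set_pmf p)"
    using J finite_support by (intro finite_PiE) auto
  have R: "?R \<in> measurable M (count_space (J \<rightarrow>\<^sub>E set_pmf p))"
    unfolding PiM_samples[OF J(1), symmetric]
    using J measurable_sample by (intro measurable_restrict) auto
  have "F \<in> borel_measurable (count_space (J \<rightarrow>\<^sub>E set_pmf p))"
    by simp
  then have "(\<lambda>\<omega>. F (?R \<omega>)) \<in> borel_measurable M"
    by (rule measurable_compose[OF R])
  moreover have "norm (F (?R \<omega>)) \<le> (\<Sum>r\<in>J \<rightarrow>\<^sub>E set_pmf p. \<bar>F r\<bar>)" if "\<omega> \<in> space M" for \<omega>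
    using measurable_space[OF R that] member_le_sum[OF _ _ fin, of "?R \<omega>" "\<lambda>r. \<bar>F r\<bar>"] by simp
  ultimately have "integrable M (\<lambda>\<omega>. F (?R \<omega>))"
    by (intro integrable_const_bound) auto
  then show ?thesis
    by (simp add: depends_on_restrict[OF F])
qed

text \<open>This replaces conditional expectation given the past \<open>J\<close>: a sample outside \<open>J\<close> may be
  integrated out first, with all samples in \<open>J\<close> held fixed.\<close>
lemma expectation_fresh_sample:
  fixes G :: "('i \<Rightarrow> 'a) \<Rightarrow> 'a \<Rightarrow> real"
  assumes G: "\<And>a. depends_on J (\<lambda>u. G u a)" and J: "finite J" "J \<subseteq> I" and k: "k \<in> I" "k \<notin> J"
  shows "sample_expectation (\<lambda>u. G u (u k))
    = sample_expectation (\<lambda>u. measure_pmf.expectation p (G u))"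
proof -
  let ?U = "\<lambda>\<omega> i. X i \<omega>"
  let ?hit = "\<lambda>a \<omega>. of_bool (X k \<omega> = a) :: real"
  have int_G: "integrable M (\<lambda>\<omega>. G (?U \<omega>) a)" for a
    using integrable_sample[OF G J] .
  have int_hit: "integrable M (?hit a)" for a
    using integrable_sample[of "{k}" "\<lambda>u. of_bool (u k = a)"] k by (simp add: depends_on_def)
  have indep_hit: "indep_var borel (\<lambda>\<omega>. G (?U \<omega>) a) borel (?hit a)" for a
  proof -
    have "indep_var borel ((\<lambda>r. G r a) \<circ> (\<lambda>\<omega>. restrict (?U \<omega>) J))
        borel ((\<lambda>r. of_bool (r k = a)) \<circ> (\<lambda>\<omega>. restrict (?U \<omega>) {k}))"
      using J k by (intro indep_var_compose[OF indep_var_restrict[OF indep]])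
        (auto simp: PiM_samples)
    then show ?thesis
      by (simp add: comp_def depends_on_restrict[OF G])
  qed
  have prob_hit: "expectation (?hit a) = pmf p a" if "a \<in> set_pmf p" for a
  proof -
    have "{\<omega> \<in> space M. X k \<omega> = a} = X k -` {a} \<inter> space M"
      by auto
    then have "{\<omega> \<in> space M. X k \<omega> = a} \<in> events"
      using measurable_sets[OF measurable_sample[OF k(1)], of "{a}"] that by simp
    then have "expectation (indicator {\<omega> \<in> space M. X k \<omega> = a}) = pmf p a"
      using law[OF k(1) that] by simp
    moreover have "expectation (?hit a) = expectation (indicator {\<omega> \<in> space M. X k \<omega> = a})"
      by (intro Bochner_Integration.integral_cong) (auto simp: indicator_def)
    ultimately show ?thesis by simp
  qed
  have "sample_expectation (\<lambda>u. G u (u k)) = expectation (\<lambda>\<omega>. \<Sum>a\<in>set_pmf p. G (?U \<omega>) a * ?hit a \<omega>)"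
  proof (rule Bochner_Integration.integral_cong[OF refl])
    fix \<omega> assume "\<omega> \<in> space M"
    then have "X k \<omega> \<in> set_pmf p"
      using sample_in_support k by blast
    then show "G (?U \<omega>) (X k \<omega>) = (\<Sum>a\<in>set_pmf p. G (?U \<omega>) a * ?hit a \<omega>)"
      using finite_support by (simp add: of_bool_def if_distrib[of "(*) _"] sum.delta' cong: if_cong)
  qed
  also have "\<dots> = (\<Sum>a\<in>set_pmf p. expectation (\<lambda>\<omega>. G (?U \<omega>) a * ?hit a \<omega>))"
    using indep_var_integrable[OF indep_hit int_G int_hit]
    by (intro Bochner_Integration.integral_sum) auto
  also have "\<dots> = (\<Sum>a\<in>set_pmf p. expectation (\<lambda>\<omega>. G (?U \<omega>) a) * pmf p a)"
    by (intro sum.cong refl) (simp add: indep_var_lebesgue_integral[OF indep_hit int_G int_hit] prob_hit)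
  also have "\<dots> = expectation (\<lambda>\<omega>. \<Sum>a\<in>set_pmf p. G (?U \<omega>) a * pmf p a)"
    using int_G by (subst Bochner_Integration.integral_sum) auto
  also have "\<dots> = sample_expectation (\<lambda>u. measure_pmf.expectation p (G u))"
    by (simp add: integral_measure_pmf_real[OF finite_support])
  finally show ?thesis .
qed

end

section \<open>Contraction over one outer iteration\<close>

lemma linear_recurrence_bound:
  fixes a r :: "nat \<Rightarrow> real"
  assumes "0 \<le> q" and "\<And>t. t < m \<Longrightarrow> a (Suc t) \<le> q * a t + r t"
  shows "a m \<le> q ^ m * a 0 + (\<Sum>t=0..<m. q ^ (m - 1 - t) * r t)"
  using assms(2)
proof (induction m)
  case (Suc m)
  have "a (Suc m) \<le> q * a m + r m"
    using Suc.prems by simp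
  also have "q * a m \<le> q * (q ^ m * a 0 + (\<Sum>t=0..<m. q ^ (m - 1 - t) * r t))"
    using Suc assms(1) by (intro mult_left_mono) auto
  also have "q * (\<Sum>t=0..<m. q ^ (m - 1 - t) * r t) = (\<Sum>t=0..<m. q ^ (Suc m - 1 - t) * r t)"
    unfolding sum_distrib_left
  proof (rule sum.cong[OF refl])
    fix t assume "t \<in> {0..<m}"
    then have "Suc m - 1 - t = Suc (m - 1 - t)"
      by auto
    then show "q * (q ^ (m - 1 - t) * r t) = q ^ (Suc m - 1 - t) * r t"
      by (simp only: power_Suc mult.assoc)
  qed
  then have "q * (q ^ m * a 0 + (\<Sum>t=0..<m. q ^ (m - 1 - t) * r t)) + r m
      = q ^ Suc m * a 0 + (\<Sum>t=0..<Suc m. q ^ (Suc m - 1 - t) * r t)"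
    by (simp add: distrib_left)
  finally show ?case by simp
qed simp

locale svrg_run = svrg_problem n b f L Lmax \<mu> \<alpha> xstar
  for n b :: nat and f :: "nat \<Rightarrow> 'a::euclidean_space \<Rightarrow> real"
    and L Lmax \<mu> \<alpha> :: real and xstar :: 'a +
  fixes m :: nat and x\<^sub>0 :: 'a
  assumes m: "1 \<le> m"
begin

abbreviation q :: real where
  "q \<equiv> 1 - \<alpha> * \<mu>"

abbreviation S :: real where
  "S \<equiv> S_sum \<alpha> \<mu> m"

lemma q_pos: "0 < q"
  using alpha_mu_le_half by simp

lemma S_pos: "0 < S"
  unfolding S_sum_def using q_pos m by (intro sum_pos) auto

text \<open>The iterates are functions of a family \<open>u\<close> of samples indexed by pairs.  Outer iterations
  count from \<open>1\<close>, so the inner loop that starts at \<open>outer_state u s\<close> reads the samples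
  \<open>u (Suc s, t)\<close>.\<close>
definition outer_state :: "(nat \<times> nat \<Rightarrow> nat \<Rightarrow> real) \<Rightarrow> nat \<Rightarrow> 'a \<times> 'a" where
  "outer_state u s = free_svrg n f \<mu> \<alpha> m x\<^sub>0 (\<lambda>s t. u (s, t)) s"

definition inner_state :: "(nat \<times> nat \<Rightarrow> nat \<Rightarrow> real) \<Rightarrow> nat \<Rightarrow> nat \<Rightarrow> 'a" where
  "inner_state u s t = inner_iter n f \<alpha> (snd (outer_state u s)) (\<lambda>t. u (Suc s, t)) (fst (outer_state u s)) t"

lemma outer_state_0: "outer_state u 0 = (x\<^sub>0, x\<^sub>0)"
  by (simp add: outer_state_def)

lemma outer_state_Suc:
  "outer_state u (Suc s)
    = (inner_state u s m, \<Sum>t=0..<m. p_weight \<alpha> \<mu> m t *\<^sub>R inner_state u s t)"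
  by (simp add: outer_state_def inner_state_def split_beta Let_def)

lemma inner_state_0: "inner_state u s 0 = fst (outer_state u s)"
  by (simp add: inner_state_def)

lemma inner_state_Suc:
  "inner_state u s (Suc t)
    = inner_state u s t - \<alpha> *\<^sub>R svrg_direction (snd (outer_state u s)) (u (Suc s, t)) (inner_state u s t)"
  by (simp add: inner_state_def svrg_direction_def Let_def)

text \<open>All indices read before step \<open>t\<close> of outer iteration \<open>Suc s\<close>.\<close>
definition past :: "nat \<Rightarrow> nat \<Rightarrow> (nat \<times> nat) set" where
  "past s t = {1..s} \<times> {0..<m} \<union> {Suc s} \<times> {0..<t}"

lemma finite_past: "finite (past s t)"
  by (simp add: past_def)

lemma past_subset: "t \<le> m \<Longrightarrow> past s t \<subseteq> {1..} \<times> {0..<m}"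
  by (auto simp: past_def)

lemma inner_state_cong:
  assumes "outer_state u s = outer_state u' s" and "\<And>i. i < t \<Longrightarrow> u (Suc s, i) = u' (Suc s, i)"
  shows "inner_state u s t = inner_state u' s t"
  using assms(2) by (induction t) (simp_all add: inner_state_0 inner_state_Suc assms(1))

lemma outer_state_cong:
  assumes "\<And>k. k \<in> {1..s} \<times> {0..<m} \<Longrightarrow> u k = u' k"
  shows "outer_state u s = outer_state u' s"
  using assms
proof (induction s)
  case (Suc s)
  have outer_state: "outer_state u s = outer_state u' s"
    using Suc.prems by (intro Suc.IH) auto
  have "inner_state u s t = inner_state u' s t" if "t \<le> m" for t
    using that Suc.prems by (intro inner_state_cong outer_state) auto
  then show ?case
    by (simp add: outer_state_Suc)
qed (simp add: outer_state_0)

lemma depends_on_past: "depends_on (past s t) (\<lambda>u. (outer_state u s, inner_state u s t))"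
  unfolding depends_on_def
proof (intro allI impI)
  fix u u' :: "nat \<times> nat \<Rightarrow> nat \<Rightarrow> real"
  assume agree: "\<forall>k\<in>past s t. u k = u' k"
  have "outer_state u s = outer_state u' s"
    using agree by (intro outer_state_cong) (auto simp: past_def)
  moreover from this have "inner_state u s t = inner_state u' s t"
    using agree by (intro inner_state_cong) (auto simp: past_def)
  ultimately show "(outer_state u s, inner_state u s t) = (outer_state u' s, inner_state u' s t)"
    by simp
qed

lemma depends_on_past_state:
  "depends_on (past s t) (\<lambda>u. h (outer_state u s) (inner_state u s t))"
  using depends_on_compose[OF depends_on_past, of _ _ "case_prod h"] by simp

lemma sum_p_weight: "(\<Sum>t=0..<m. p_weight \<alpha> \<mu> m t) = 1"
  using S_pos by (simp add: p_weight_def flip: sum_divide_distrib) (simp add: S_sum_def)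

text \<open>Jensen's inequality for the reference point: the tangent at the weighted average lies below
  the function, and its linear part averages to zero.\<close>
lemma gap_weighted_average:
  "S * gap (\<Sum>t=0..<m. p_weight \<alpha> \<mu> m t *\<^sub>R y t) \<le> (\<Sum>t=0..<m. q ^ (m - 1 - t) * gap (y t))"
proof -
  let ?z = "\<Sum>t=0..<m. p_weight \<alpha> \<mu> m t *\<^sub>R y t"
  let ?g = "gradient (avg n f) ?z"
  have tangent: "gap ?z + ?g \<bullet> (y t - ?z) \<le> gap (y t)" for t
  proof -
    have "avg n f ?z \<le> avg n f (y t) + ?g \<bullet> (?z - y t) - \<mu> / 2 * (norm (?z - y t))\<^sup>2"
      using sconv unfolding strongly_convex_def by blast
    moreover have "0 \<le> \<mu> / 2 * (norm (?z - y t))\<^sup>2"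
      using mu by simp
    ultimately show ?thesis
      by (simp add: inner_diff_right)
  qed
  have "(\<Sum>t=0..<m. p_weight \<alpha> \<mu> m t * (gap ?z + ?g \<bullet> (y t - ?z)))
      \<le> (\<Sum>t=0..<m. p_weight \<alpha> \<mu> m t * gap (y t))"
    using q_pos S_pos by (intro sum_mono mult_left_mono tangent) (auto simp: p_weight_def)
  also have "(\<Sum>t=0..<m. p_weight \<alpha> \<mu> m t * (gap ?z + ?g \<bullet> (y t - ?z)))
      = (\<Sum>t=0..<m. p_weight \<alpha> \<mu> m t) * (gap ?z - ?g \<bullet> ?z)
        + ?g \<bullet> (\<Sum>t=0..<m. p_weight \<alpha> \<mu> m t *\<^sub>R y t)"
    by (simp only: sum_distrib_right inner_sum_right inner_scaleR_right inner_diff_right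
        flip: sum.distrib) (simp add: algebra_simps)
  also have "\<dots> = gap ?z"
    by (simp only: sum_p_weight) simp
  finally have "S * gap ?z \<le> S * (\<Sum>t=0..<m. p_weight \<alpha> \<mu> m t * gap (y t))"
    using S_pos by (intro mult_left_mono) auto
  also have "\<dots> = (\<Sum>t=0..<m. q ^ (m - 1 - t) * gap (y t))"
    using S_pos by (simp add: sum_distrib_left p_weight_def)
  finally show ?thesis .
qed

abbreviation potential :: "'a \<times> 'a \<Rightarrow> real" where
  "potential xw \<equiv> (norm (fst xw - xstar))\<^sup>2 + 8 * \<alpha>\<^sup>2 * \<rho> * S * gap (snd xw)"

abbreviation rate :: real where
  "rate \<equiv> max (q ^ m) (1 / 2)"

end

locale random_svrg_run =
  svrg_run n b f L Lmax \<mu> \<alpha> xstar m x\<^sub>0 +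
  independent_samples M X "{1..} \<times> {0..<m}" "nice_sampling n b"
  for n b :: nat and f :: "nat \<Rightarrow> 'a::euclidean_space \<Rightarrow> real"
    and L Lmax \<mu> \<alpha> :: real and xstar :: 'a and m :: nat and x\<^sub>0 :: 'a
    and M :: "'w measure" and X :: "nat \<times> nat \<Rightarrow> 'w \<Rightarrow> nat \<Rightarrow> real"
begin

lemma integrable_state [simp, intro]:
  fixes h :: "'a \<times> 'a \<Rightarrow> 'a \<Rightarrow> real"
  assumes "t \<le> m"
  shows "integrable M (\<lambda>\<omega>. h (outer_state (\<lambda>k. X k \<omega>) s) (inner_state (\<lambda>k. X k \<omega>) s t))"
  by (rule integrable_sample[OF depends_on_past_state finite_past past_subset[OF assms]])

lemma integrable_outer_state [simp, intro]:
  fixes h :: "'a \<times> 'a \<Rightarrow> real"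
  shows "integrable M (\<lambda>\<omega>. h (outer_state (\<lambda>k. X k \<omega>) s))"
  using integrable_state[of 0 "\<lambda>xw _. h xw"] by simp

lemma integrable_inner_state [simp, intro]:
  fixes h :: "'a \<Rightarrow> real"
  shows "t \<le> m \<Longrightarrow> integrable M (\<lambda>\<omega>. h (inner_state (\<lambda>k. X k \<omega>) s t))"
  using integrable_state[of t "\<lambda>_. h"] by simp

text \<open>The sample of step \<open>t\<close> is independent of the state that it is applied to, so it can be
  integrated out first, where the bound for fixed \<open>x\<close> and \<open>w\<close> applies.\<close>
lemma expected_inner_step:
  assumes t: "t < m"
  shows "sample_expectation (\<lambda>u. (norm (inner_state u s (Suc t) - xstar))\<^sup>2)
    \<le> q * sample_expectation (\<lambda>u. (norm (inner_state u s t - xstar))\<^sup>2)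
      + (4 * \<alpha>\<^sup>2 * \<rho> * sample_expectation (\<lambda>u. gap (snd (outer_state u s)))
        - 8 * \<alpha>\<^sup>2 * \<rho> * sample_expectation (\<lambda>u. gap (inner_state u s t)))"
proof -
  define h where "h = (\<lambda>(xw :: 'a \<times> 'a) y a. (norm (y - \<alpha> *\<^sub>R svrg_direction (snd xw) a y - xstar))\<^sup>2)"
  have "sample_expectation (\<lambda>u. (norm (inner_state u s (Suc t) - xstar))\<^sup>2)
      = sample_expectation (\<lambda>u. h (outer_state u s) (inner_state u s t) (u (Suc s, t)))"
    by (simp add: inner_state_Suc h_def)
  also have "\<dots> = sample_expectation (\<lambda>u. sampling_expectation (h (outer_state u s) (inner_state u s t)))"
  proof (rule expectation_fresh_sample)
    show "depends_on (past s t) (\<lambda>u. h (outer_state u s) (inner_state u s t) a)" for a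
      by (rule depends_on_past_state)
  qed (use t in \<open>auto simp: past_def\<close>)
  also have "\<dots> \<le> sample_expectation (\<lambda>u. q * (norm (inner_state u s t - xstar))\<^sup>2
      - 8 * \<alpha>\<^sup>2 * \<rho> * gap (inner_state u s t) + 4 * \<alpha>\<^sup>2 * \<rho> * gap (snd (outer_state u s)))"
  proof (rule integral_mono)
    show "integrable M (\<lambda>\<omega>. sampling_expectation
        (h (outer_state (\<lambda>k. X k \<omega>) s) (inner_state (\<lambda>k. X k \<omega>) s t)))"
      using t by (intro integrable_state[of t "\<lambda>xw y. sampling_expectation (h xw y)"]) simp
    show "integrable M (\<lambda>\<omega>. q * (norm (inner_state (\<lambda>k. X k \<omega>) s t - xstar))\<^sup>2
        - 8 * \<alpha>\<^sup>2 * \<rho> * gap (inner_state (\<lambda>k. X k \<omega>) s t) + 4 * \<alpha>\<^sup>2 * \<rho> * gap (snd (outer_state (\<lambda>k. X k \<omega>) s)))"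
      using t by (intro integrable_state[of t "\<lambda>xw y. q * (norm (y - xstar))\<^sup>2
        - 8 * \<alpha>\<^sup>2 * \<rho> * gap y + 4 * \<alpha>\<^sup>2 * \<rho> * gap (snd xw)"]) simp
  qed (simp add: h_def expected_step)
  also have "\<dots> = q * sample_expectation (\<lambda>u. (norm (inner_state u s t - xstar))\<^sup>2)
      - 8 * \<alpha>\<^sup>2 * \<rho> * sample_expectation (\<lambda>u. gap (inner_state u s t))
      + 4 * \<alpha>\<^sup>2 * \<rho> * sample_expectation (\<lambda>u. gap (snd (outer_state u s)))"
  proof -
    have "integrable M (\<lambda>\<omega>. (norm (inner_state (\<lambda>k. X k \<omega>) s t - xstar))\<^sup>2)"
      "integrable M (\<lambda>\<omega>. gap (inner_state (\<lambda>k. X k \<omega>) s t))"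
      "integrable M (\<lambda>\<omega>. gap (snd (outer_state (\<lambda>k. X k \<omega>) s)))"
      using t integrable_inner_state[of t "\<lambda>y. (norm (y - xstar))\<^sup>2"] integrable_inner_state[of t gap]
        integrable_outer_state[of "\<lambda>xw. gap (snd xw)"] by auto
    then show ?thesis
      by (simp only: Bochner_Integration.integral_add Bochner_Integration.integral_diff
        Bochner_Integration.integrable_diff Bochner_Integration.integrable_add
        integrable_mult_right integral_mult_right_zero)
  qed
  finally show ?thesis by simp
qed

text \<open>The decrease collected along the loop, \<open>8 \<alpha>\<^sup>2 \<rho>\<close> times the weighted sum of the gaps,
  dominates the reference part of the new potential by Jensen's inequality.\<close>
lemma expected_potential_step:
  "sample_expectation (\<lambda>u. potential (outer_state u (Suc s)))
    \<le> rate * sample_expectation (\<lambda>u. potential (outer_state u s))"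
proof -
  define c where "c = 4 * \<alpha>\<^sup>2 * \<rho>"
  define dst where "dst t = sample_expectation (\<lambda>u. (norm (inner_state u s t - xstar))\<^sup>2)" for t
  define d where "d t = sample_expectation (\<lambda>u. gap (inner_state u s t))" for t
  define e where "e = sample_expectation (\<lambda>u. gap (snd (outer_state u s)))"
  have c: "8 * \<alpha>\<^sup>2 * \<rho> = 2 * c" "0 \<le> c"
    using exp_residual_nonneg by (simp_all add: c_def)
  have e: "0 \<le> e"
    unfolding e_def using gap_nonneg by (intro Bochner_Integration.integral_nonneg) auto
  have dst_0: "0 \<le> dst 0"
    unfolding dst_def by (intro Bochner_Integration.integral_nonneg) auto
  have int_dist: "integrable M (\<lambda>\<omega>. (norm (inner_state (\<lambda>k. X k \<omega>) s t - xstar))\<^sup>2)"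
    and int_gap: "integrable M (\<lambda>\<omega>. gap (inner_state (\<lambda>k. X k \<omega>) s t))" if "t \<le> m" for t
    using that integrable_inner_state[of t "\<lambda>y. (norm (y - xstar))\<^sup>2"] integrable_inner_state[of t gap] by auto
  have step: "dst (Suc t) \<le> q * dst t + (c * e - 2 * c * d t)" if "t < m" for t
    using expected_inner_step[OF that, of s] unfolding c(1) unfolding dst_def d_def e_def c_def .
  have loop: "dst m + 2 * c * (\<Sum>t=0..<m. q ^ (m - 1 - t) * d t) \<le> q ^ m * dst 0 + c * S * e"
  proof -
    have "dst m \<le> q ^ m * dst 0 + (\<Sum>t=0..<m. q ^ (m - 1 - t) * (c * e - 2 * c * d t))"
      using q_pos by (intro linear_recurrence_bound step) auto
    also have "(\<Sum>t=0..<m. q ^ (m - 1 - t) * (c * e - 2 * c * d t))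
        = c * S * e - 2 * c * (\<Sum>t=0..<m. q ^ (m - 1 - t) * d t)"
      unfolding S_sum_def by (simp add: sum_distrib_left sum_distrib_right right_diff_distrib
        sum_subtractf mult_ac)
    finally show ?thesis by simp
  qed
  have "sample_expectation (\<lambda>u. potential (outer_state u (Suc s)))
      \<le> sample_expectation (\<lambda>u. (norm (inner_state u s m - xstar))\<^sup>2
          + 2 * c * (\<Sum>t=0..<m. q ^ (m - 1 - t) * gap (inner_state u s t)))"
  proof (rule integral_mono)
    show "integrable M (\<lambda>\<omega>. potential (outer_state (\<lambda>k. X k \<omega>) (Suc s)))"
      by (rule integrable_outer_state)
    show "integrable M (\<lambda>\<omega>. (norm (inner_state (\<lambda>k. X k \<omega>) s m - xstar))\<^sup>2
        + 2 * c * (\<Sum>t=0..<m. q ^ (m - 1 - t) * gap (inner_state (\<lambda>k. X k \<omega>) s t)))"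
      using int_dist int_gap
      by (intro Bochner_Integration.integrable_add integrable_mult_right
          Bochner_Integration.integrable_sum) auto
    fix \<omega> assume "\<omega> \<in> space M"
    let ?u = "\<lambda>k. X k \<omega>"
    have "2 * c * (S * gap (snd (outer_state ?u (Suc s))))
        \<le> 2 * c * (\<Sum>t=0..<m. q ^ (m - 1 - t) * gap (inner_state ?u s t))"
      using c(2) gap_weighted_average[of "inner_state ?u s"] by (intro mult_left_mono) (auto simp: outer_state_Suc)
    then show "potential (outer_state ?u (Suc s)) \<le> (norm (inner_state ?u s m - xstar))\<^sup>2
        + 2 * c * (\<Sum>t=0..<m. q ^ (m - 1 - t) * gap (inner_state ?u s t))"
      unfolding c(1) by (simp add: outer_state_Suc mult.assoc)
  qed
  also have "\<dots> = dst m + 2 * c * (\<Sum>t=0..<m. q ^ (m - 1 - t) * d t)"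
  proof -
    have "sample_expectation (\<lambda>u. \<Sum>t=0..<m. q ^ (m - 1 - t) * gap (inner_state u s t))
        = (\<Sum>t=0..<m. q ^ (m - 1 - t) * d t)"
      unfolding d_def integral_mult_right_zero[symmetric] using int_gap
      by (intro Bochner_Integration.integral_sum integrable_mult_right) auto
    moreover have "integrable M (\<lambda>\<omega>. \<Sum>t=0..<m. q ^ (m - 1 - t) * gap (inner_state (\<lambda>k. X k \<omega>) s t))"
      using int_gap by (intro Bochner_Integration.integrable_sum integrable_mult_right) auto
    ultimately show ?thesis
      using int_dist[of m] unfolding dst_def
      by (simp only: Bochner_Integration.integral_add integrable_mult_right integral_mult_right_zero
          order_refl)
  qed
  also have "\<dots> \<le> q ^ m * dst 0 + c * S * e"
    by (rule loop)
  also have "\<dots> \<le> rate * dst 0 + rate * (2 * c * S * e)"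
  proof (rule add_mono)
    show "q ^ m * dst 0 \<le> rate * dst 0"
      using dst_0 by (intro mult_right_mono) auto
    have "1 / 2 * (2 * c * S * e) \<le> rate * (2 * c * S * e)"
      using c(2) e S_pos by (intro mult_right_mono) auto
    then show "c * S * e \<le> rate * (2 * c * S * e)"
      by simp
  qed
  also have "\<dots> = rate * sample_expectation (\<lambda>u. potential (outer_state u s))"
  proof -
    have "sample_expectation (\<lambda>u. potential (outer_state u s)) = dst 0 + 2 * c * S * e"
      using int_dist[of 0] integrable_outer_state[of "\<lambda>xw. gap (snd xw)" s]
      unfolding dst_def e_def c(1) inner_state_0
      by (simp only: Bochner_Integration.integral_add integrable_mult_right integral_mult_right_zero
          le0)
    then show ?thesis
      by (simp only: distrib_left)
  qed
  finally show ?thesis .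
qed

lemma expected_potential:
  "sample_expectation (\<lambda>u. potential (outer_state u s)) \<le> rate ^ s * potential (x\<^sub>0, x\<^sub>0)"
proof (induction s)
  case 0
  show ?case
    by (simp add: outer_state_0 prob_space)
next
  case (Suc s)
  have "sample_expectation (\<lambda>u. potential (outer_state u (Suc s)))
      \<le> rate * sample_expectation (\<lambda>u. potential (outer_state u s))"
    by (rule expected_potential_step)
  also have "\<dots> \<le> rate * (rate ^ s * potential (x\<^sub>0, x\<^sub>0))"
    by (intro mult_left_mono Suc.IH) simp
  finally show ?case
    by (simp only: power_Suc mult.assoc)
qed

lemma expected_distance:
  "sample_expectation (\<lambda>u. (norm (fst (outer_state u s) - xstar))\<^sup>2) \<le> rate ^ s * potential (x\<^sub>0, x\<^sub>0)"
proof -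
  have "sample_expectation (\<lambda>u. (norm (fst (outer_state u s) - xstar))\<^sup>2)
      \<le> sample_expectation (\<lambda>u. potential (outer_state u s))"
    using exp_residual_nonneg S_pos gap_nonneg
    by (intro integral_mono integrable_outer_state) simp
  then show ?thesis
    using expected_potential[of s] by simp
qed

end

section \<open>From the contraction rate to the complexity\<close>

context svrg_run
begin

text \<open>For \<open>\<epsilon> \<ge> 1\<close> it suffices that the rate is at most \<open>1\<close>.  Otherwise, dividing the
  cost of \<open>s\<close> outer iterations by the cost \<open>(n + 2bm) / m\<close> of one inner step bounds the number \<open>s * m\<close> of inner steps below by \<open>2 * max ((\<L> + 2 * \<rho>) / \<mu>) m * ln (1 / \<epsilon>)\<close>.
  Since \<open>2 * \<alpha> * (\<L> + 2 * \<rho>) = 1\<close>, the first term of the maximum gives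
  \<open>\<alpha> * \<mu> * s * m \<ge> ln (1 / \<epsilon>)\<close> and the second \<open>s / 2 \<ge> ln (1 / \<epsilon>)\<close>; both powers are then
  compared with exponentials through \<open>1 - x \<le> exp (- x)\<close>.\<close>
lemma rate_power_le:
  assumes eps: "0 < \<epsilon>"
    and s: "total_complexity n Lmax L \<mu> \<epsilon> m b \<le> real s * (real n + 2 * real b * real m)"
  shows "rate ^ s \<le> \<epsilon>"
proof (cases "1 \<le> \<epsilon>")
  case True
  have "rate \<le> 1"
    using q_pos alpha_pos mu by (auto intro!: power_le_one)
  moreover have "0 \<le> rate"
    by simp
  ultimately have "rate ^ s \<le> 1"
    by (rule power_le_one[rotated])
  then show ?thesis
    using True by simp
next
  case False
  define l where "l = ln (1 / \<epsilon>)"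
  define N where "N = real n + 2 * real b * real m"
  define K where "K = max ((\<L> + 2 * \<rho>) / \<mu>) (real m)"
  have l: "0 \<le> l" "exp (- l) = \<epsilon>"
    using False eps by (auto simp: l_def ln_div)
  have N: "0 < N" and m_pos: "0 < real m"
    using n m by (auto simp: N_def intro: add_pos_nonneg)
  have "total_complexity n Lmax L \<mu> \<epsilon> m b = 2 * (N / real m) * K * l"
    using m_pos by (simp add: total_complexity_def N_def K_def l_def field_simps)
  then have "N * (2 * K * l) = real m * total_complexity n Lmax L \<mu> \<epsilon> m b"
    using m_pos by (simp add: field_simps)
  also have "\<dots> \<le> real m * (real s * N)"
    using s m_pos by (intro mult_left_mono) (auto simp: N_def)
  finally have "N * (2 * K * l) \<le> N * (real s * real m)"
    by (simp only: mult_ac)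
  then have steps: "2 * K * l \<le> real s * real m"
    using N by simp
  have "(q ^ m) ^ s \<le> \<epsilon>"
  proof -
    have "l = (2 * \<alpha> * (\<L> + 2 * \<rho>)) * l"
      by (simp only: alpha_eq mult_1_left)
    also have "\<dots> = \<alpha> * \<mu> * (2 * ((\<L> + 2 * \<rho>) / \<mu>) * l)"
      using mu by simp
    also have "\<dots> \<le> \<alpha> * \<mu> * (2 * K * l)"
      using alpha_pos mu l by (intro mult_left_mono mult_right_mono) (auto simp: K_def)
    also have "\<dots> \<le> \<alpha> * \<mu> * (real s * real m)"
      using alpha_pos mu steps by (intro mult_left_mono) auto
    finally have "exp (- (\<alpha> * \<mu> * (real s * real m))) \<le> \<epsilon>"
      using l(2) by (metis exp_le_cancel_iff neg_le_iff_le)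
    moreover have "q ^ (m * s) \<le> exp (- (\<alpha> * \<mu>)) ^ (m * s)"
      using q_pos exp_ge_add_one_self[of "- (\<alpha> * \<mu>)"] by (intro power_mono) auto
    moreover have "exp (- (\<alpha> * \<mu>)) ^ (m * s) = exp (- (\<alpha> * \<mu> * (real s * real m)))"
      by (simp add: mult_ac flip: exp_of_nat_mult)
    ultimately show ?thesis
      by (simp add: power_mult)
  qed
  moreover have "(1 / 2) ^ s \<le> \<epsilon>"
  proof -
    have "2 * real m * l \<le> 2 * K * l"
      using l by (intro mult_right_mono) (auto simp: K_def)
    then have "real m * (2 * l) \<le> real m * real s"
      using steps by (simp add: mult_ac)
    then have "l \<le> real s * (1 / 2)"
      using m_pos by simp
    then have "exp (- (real s * (1 / 2))) \<le> \<epsilon>"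
      using l(2) by (metis exp_le_cancel_iff neg_le_iff_le)
    moreover have "(1 / 2) ^ s \<le> exp (- (1 / 2) :: real) ^ s"
      using exp_ge_add_one_self[of "- (1 / 2) :: real"] by (intro power_mono) auto
    moreover have "exp (- (1 / 2) :: real) ^ s = exp (- (real s * (1 / 2)))"
      by (simp flip: exp_of_nat_mult)
    ultimately show ?thesis
      by linarith
  qed
  ultimately show ?thesis
    by (simp add: max_def)
qed

lemma potential_nonneg: "0 \<le> potential xw"
  using exp_residual_nonneg S_pos gap_nonneg by simp

end

theorem corollary4p1:
  fixes n b m s :: nat
    and f :: "nat \<Rightarrow> real ^ 'd \<Rightarrow> real"
    and Li :: "nat \<Rightarrow> real"
    and L Lmax \<mu> \<alpha> \<epsilon> \<phi>\<^sub>0 :: real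
    and xstar x\<^sub>0 :: "real ^ 'd"
    and M :: "'w measure"
    and v :: "nat \<Rightarrow> nat \<Rightarrow> 'w \<Rightarrow> nat \<Rightarrow> real"
  assumes "n \<ge> 2"
    and "\<And>i x. i \<in> {1..n} \<Longrightarrow> f i differentiable (at x)"
    and "\<And>i. i \<in> {1..n} \<Longrightarrow> convex_on UNIV (f i)"
    and "\<And>i. i \<in> {1..n} \<Longrightarrow> smooth (Li i) (f i)"
    and "Lmax = Max (Li ` {1..n})"
    and "smooth L (avg n f)"
    and "\<mu> > 0"
    and "strongly_convex \<mu> (avg n f)"
    and "\<And>x. avg n f xstar \<le> avg n f x"
    and "b \<in> {1..n}"
    and "m \<ge> 1"
    and "\<alpha> = 1 / (2 * (exp_smoothness n Lmax L b + 2 * exp_residual n Lmax b))"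
    and "prob_space M"
    and "prob_space.indep_vars M (\<lambda>_. count_space UNIV) (\<lambda>(s, t). v s t) ({1..} \<times> {0..<m})"
    and "\<And>s t. s \<ge> 1 \<Longrightarrow> t < m \<Longrightarrow>
           distr M (count_space UNIV) (v s t) = measure_pmf (nice_sampling n b)"
    and "\<phi>\<^sub>0 = (norm (x\<^sub>0 - xstar))\<^sup>2
           + 8 * \<alpha>\<^sup>2 * exp_residual n Lmax b * S_sum \<alpha> \<mu> m * (avg n f x\<^sub>0 - avg n f xstar)"
    and "\<epsilon> > 0"
    and "real s * (real n + 2 * real b * real m) \<ge> total_complexity n Lmax L \<mu> \<epsilon> m b"
  shows "(\<integral>\<omega>. (norm (fst (free_svrg n f \<mu> \<alpha> m x\<^sub>0 (\<lambda>s t. v s t \<omega>) s) - xstar))\<^sup>2 \<partial>M)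
           \<le> \<epsilon> * \<phi>\<^sub>0"
proof -
  have smooth_max: "smooth Lmax (f i)" if "i \<in> {1..n}" for i
    using that by (intro smooth_mono[OF assms(4)]) (auto simp: assms(5))
  interpret svrg_run n b f L Lmax \<mu> \<alpha> xstar m x\<^sub>0
    by unfold_locales (fact assms smooth_max)+
  interpret prob_space M
    by (fact assms(13))
  let ?p = "nice_sampling n b"
  \<comment> \<open>\<open>X\<close> agrees with \<open>v\<close> almost surely and takes values in the finite support everywhere.\<close>
  obtain a\<^sub>0 where a\<^sub>0: "a\<^sub>0 \<in> set_pmf ?p"
    using set_pmf_not_empty[of ?p] by blast
  define retract where "retract a = (if a \<in> set_pmf ?p then a else a\<^sub>0)" for a
  define X where "X k \<omega> = retract ((\<lambda>(s, t). v s t) k \<omega>)" for k \<omega>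
  have indep_v: "indep_vars (\<lambda>_. count_space UNIV) (\<lambda>(s, t). v s t) ({1..} \<times> {0..<m})"
    by (fact assms(14))
  have measurable_v: "v s t \<in> measurable M (count_space UNIV)" if "1 \<le> s" "t < m" for s t
    using indep_v that by (auto simp: indep_vars_def)
  have indep_X: "indep_vars (\<lambda>_. count_space (set_pmf ?p)) X ({1..} \<times> {0..<m})"
    unfolding X_def[abs_def] using a\<^sub>0
    by (intro indep_vars_compose2[OF indep_v]) (auto simp: retract_def)
  have law_X: "prob {\<omega> \<in> space M. X k \<omega> = a} = pmf ?p a"
    if k: "k \<in> {1..} \<times> {0..<m}" and a: "a \<in> set_pmf ?p" for k a
  proof -
    obtain s t where st: "k = (s, t)" "1 \<le> s" "t < m"
      using k by auto
    have "prob {\<omega> \<in> space M. X k \<omega> = a}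
        = measure (distr M (count_space UNIV) (v s t)) {c. retract c = a}"
      using measurable_v[OF st(2,3)] st(1)
      by (subst measure_distr) (auto simp: X_def intro!: arg_cong[where f = prob])
    also have "\<dots> = measure_pmf.prob ?p ({c. retract c = a} \<inter> set_pmf ?p)"
      using assms(15)[OF st(2,3)] by (simp add: measure_Int_set_pmf)
    also have "{c. retract c = a} \<inter> set_pmf ?p = {a}"
      using a by (auto simp: retract_def)
    finally show ?thesis
      by (simp add: measure_pmf_single)
  qed
  interpret random_svrg_run n b f L Lmax \<mu> \<alpha> xstar m x\<^sub>0 M X
    by unfold_locales (fact finite_nice_sampling indep_X law_X)+
  let ?dist = "\<lambda>u. (norm (fst (outer_state u s) - xstar))\<^sup>2"
  have "AE \<omega> in M. \<forall>k\<in>{1..s} \<times> {0..<m}. (\<lambda>(s, t). v s t \<omega>) k = X k \<omega>"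
  proof (rule AE_finite_allI)
    fix k assume "k \<in> {1..s} \<times> {0..<m}"
    then obtain s t where st: "k = (s, t)" "1 \<le> s" "t < m"
      by auto
    have "AE a in distr M (count_space UNIV) (v s t). a \<in> set_pmf ?p"
      unfolding assms(15)[OF st(2,3)] by (rule AE_measure_pmf)
    then have "AE \<omega> in M. v s t \<omega> \<in> set_pmf ?p"
      by (rule AE_distrD[OF measurable_v[OF st(2,3)]])
    then show "AE \<omega> in M. (\<lambda>(s, t). v s t \<omega>) k = X k \<omega>"
      by eventually_elim (simp add: st(1) X_def retract_def)
  qed simp
  then have eq: "AE \<omega> in M. ?dist (\<lambda>(s, t). v s t \<omega>) = ?dist (\<lambda>k. X k \<omega>)"
  proof eventually_elim
    case (elim \<omega>)
    then have "outer_state (\<lambda>(s, t). v s t \<omega>) s = outer_state (\<lambda>k. X k \<omega>) s"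
      by (intro outer_state_cong) blast
    then show ?case
      by (simp only:)
  qed
  have bound: "sample_expectation ?dist \<le> \<epsilon> * \<phi>\<^sub>0"
  proof -
    have "sample_expectation ?dist \<le> rate ^ s * potential (x\<^sub>0, x\<^sub>0)"
      by (rule expected_distance)
    also have "\<dots> \<le> \<epsilon> * potential (x\<^sub>0, x\<^sub>0)"
      using assms(17,18) by (intro mult_right_mono rate_power_le potential_nonneg)
    finally show ?thesis
      by (simp add: assms(16))
  qed
  have "(\<integral>\<omega>. ?dist (\<lambda>(s, t). v s t \<omega>) \<partial>M) \<le> \<epsilon> * \<phi>\<^sub>0"
  proof (cases "integrable M (\<lambda>\<omega>. ?dist (\<lambda>(s, t). v s t \<omega>))")
    case True
    then have "(\<integral>\<omega>. ?dist (\<lambda>(s, t). v s t \<omega>) \<partial>M) = sample_expectation ?dist"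
      using integrable_outer_state[of "\<lambda>xw. (norm (fst xw - xstar))\<^sup>2" s]
      by (intro integral_cong_AE eq borel_measurable_integrable)
    then show ?thesis
      using bound by simp
  next
    \<comment> \<open>The distance along \<open>v\<close> may fail to be measurable on the null set where \<open>v\<close> leaves the
      support; its integral is \<open>0\<close> by convention then.\<close>
    case False
    then show ?thesis
      using assms(16,17) potential_nonneg[of "(x\<^sub>0, x\<^sub>0)"] by (simp add: not_integrable_integral_eq)
  qed
  then show ?thesis
    by (simp add: outer_state_def)
qed

end
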